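(* Let $f\colon\{-1,1\}^{n^2}\to\{-1,1\}$ be given by $f(x)=\mathrm{sign}\left(1+\sum_{i=1}^n\sum_{j=1}^n 2^ix_{ij}\right)$. Then for $1/3<\epsilon<1$, \[\mathrm{rdeg}_\epsilon(f)=\Theta\left(1+\frac{n}{\log\{1/(1-\epsilon)\}}\right).\] Furthermore, for all $\epsilon>0$, $\mathrm{rdeg}_\epsilon(f)\leq 64n\lceil\log_2 n\rceil+1$.
   Context: For $h\colon Z\to\{-1,1\}$, $\mathrm{rdeg}_\epsilon(h)$ denotes the least degree of a rational function $A=p/q$ (with $q$ nonvanishing on $Z$) such that $\max_{z\in Z}|h(z)-A(z)|\leq\epsilon$; the degree of $p/q$ is $\max(\deg p,\deg q)$ with total degree of multivariate polynomials. *)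

theory Defs
  imports Complex_Main "HOL-Library.Poly_Mapping" "HOL-Library.FuncSet"
begin

text \<open>
  Real multivariate polynomials with variables of type \<open>'v\<close>: a monomial is a finitely supported
  exponent function, and a polynomial is a finitely supported map from monomials to coefficients.
\<close>

type_synonym 'v rpoly = "('v \<Rightarrow>\<^sub>0 nat) \<Rightarrow>\<^sub>0 real"

definition mono_deg :: "('v \<Rightarrow>\<^sub>0 nat) \<Rightarrow> nat" where
  "mono_deg m = (\<Sum>v\<in>Poly_Mapping.keys m. Poly_Mapping.lookup m v)"

text \<open>The zero polynomial gets total degree 0.\<close>

definition total_deg :: "'v rpoly \<Rightarrow> nat" where
  "total_deg p = Max (insert 0 (mono_deg ` Poly_Mapping.keys p))"

definition poly_vars :: "'v rpoly \<Rightarrow> 'v set" where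
  "poly_vars p = (\<Union>m\<in>Poly_Mapping.keys p. Poly_Mapping.keys m)"

definition poly_eval :: "'v rpoly \<Rightarrow> ('v \<Rightarrow> real) \<Rightarrow> real" where
  "poly_eval p x = (\<Sum>m\<in>Poly_Mapping.keys p. Poly_Mapping.lookup p m *
     (\<Prod>v\<in>Poly_Mapping.keys m. x v ^ Poly_Mapping.lookup m v))"

text \<open>
  \<open>rdeg V Z h \<epsilon>\<close> is the least degree of a rational function in the variables \<open>V\<close>, with
  denominator nonvanishing on \<open>Z\<close>, that approximates \<open>h\<close> on \<open>Z\<close> within \<open>\<epsilon>\<close> uniformly. The
  \<open>LEAST\<close> is attained whenever \<open>Z\<close> is a finite set of points determined by their
  \<open>V\<close>-coordinates and \<open>\<epsilon> \<ge> 0\<close>, since \<open>h\<close> can then be interpolated exactly by a polynomial.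
\<close>

definition rdeg :: "'v set \<Rightarrow> ('v \<Rightarrow> real) set \<Rightarrow> (('v \<Rightarrow> real) \<Rightarrow> real) \<Rightarrow> real \<Rightarrow> nat" where
  "rdeg V Z h \<epsilon> = (LEAST d. \<exists>p q.
     poly_vars p \<subseteq> V \<and> poly_vars q \<subseteq> V \<and>
     (\<forall>z\<in>Z. poly_eval q z \<noteq> 0) \<and>
     (\<forall>z\<in>Z. \<bar>h z - poly_eval p z / poly_eval q z\<bar> \<le> \<epsilon>) \<and>
     d = max (total_deg p) (total_deg q))"

definition grid :: "nat \<Rightarrow> (nat \<times> nat) set" where
  "grid n = {1..n} \<times> {1..n}"

definition sign_cube :: "'v set \<Rightarrow> ('v \<Rightarrow> real) set" where
  "sign_cube V = (V \<rightarrow>\<^sub>E {-1, 1})"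

text \<open>On \<open>sign_cube (grid n)\<close> the argument of \<open>sgn\<close> is an odd integer, so the value is \<open>\<plusminus>1\<close>.\<close>

definition halfspace :: "nat \<Rightarrow> (nat \<times> nat \<Rightarrow> real) \<Rightarrow> real" where
  "halfspace n x = sgn (1 + (\<Sum>i=1..n. \<Sum>j=1..n. 2 ^ i * x (i, j)))"

end

theory Submission
  imports Defs "HOL-Computational_Algebra.Polynomial" "HOL-Library.Nat_Bijection"
begin

text \<open>
  Upper bounds. Newman's function \<open>(A(t) - A(-t)) / (A(t) + A(-t))\<close> with \<open>A(t) = \<Prod>i<D. t + K ^ i\<close>
  takes values in \<open>[1/K, K]\<close> on \<open>[1, K ^ D]\<close>; composing it with the linear form of the halfspace
  gives the bound that depends on \<open>\<epsilon>\<close>. For the bound uniform in \<open>\<epsilon>\<close>, evaluate the linear form from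
  the heaviest row downwards: the sign is decided at the first level whose partial sum has modulus at
  least \<open>n\<close>, and this partial sum has modulus at most \<open>3 n\<close>. Hence a polynomial of degree \<open>8 n\<close>
  detects the decisive level, and weighting the levels by powers of a large \<open>M\<close> makes it dominate.

  Lower bound. Fill all rows but the last one at random, conditioned on the residue of their weighted
  sum modulo \<open>2 ^ (n - 1)\<close>, and use the last row to make the total exactly \<open>z\<close>, up to an affine
  change of scale. Few cells of this random filling are independent of the residue, so
  averaging turns a polynomial of small degree \<open>d\<close> in the cells into a polynomial of degree
  at most \<open>d\<close> in \<open>z\<close>. This leaves rational approximation of the sign on the points \<open>\<plusminus> 2 ^ k\<close>, \<open>k < n\<close>.
  There, by pigeonhole, both numerator and denominator are governed by a single monomial on a window
  of about \<open>n / d\<close> consecutive \<open>k\<close>. The dominant degrees are odd and even respectively, hence different,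
  so the quotient varies by a factor exponential in the length of the window,
  while it may only vary by a factor of order \<open>1 / (1 - \<epsilon>)\<close>.
\<close>

section \<open>Polynomial functions of bounded degree\<close>

definition poly_fun :: "'v set \<Rightarrow> nat \<Rightarrow> (('v \<Rightarrow> real) \<Rightarrow> real) set" where
  "poly_fun V d = {poly_eval p | p. poly_vars p \<subseteq> V \<and> total_deg p \<le> d}"

abbreviation monom_eval :: "('v \<Rightarrow>\<^sub>0 nat) \<Rightarrow> ('v \<Rightarrow> real) \<Rightarrow> real" where
  "monom_eval m x \<equiv> (\<Prod>v\<in>Poly_Mapping.keys m. x v ^ Poly_Mapping.lookup m v)"

lemma total_deg_le_iff: "total_deg p \<le> d \<longleftrightarrow> (\<forall>m\<in>Poly_Mapping.keys p. mono_deg m \<le> d)"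
  by (simp add: total_deg_def)

lemma poly_fun_mono: "g \<in> poly_fun V d \<Longrightarrow> d \<le> e \<Longrightarrow> g \<in> poly_fun V e"
  unfolding poly_fun_def by fastforce

lemma poly_fun_monom:
  assumes "Poly_Mapping.keys m \<subseteq> V" "mono_deg m \<le> d"
  shows "(\<lambda>x. c * monom_eval m x) \<in> poly_fun V d"
proof -
  have "poly_eval (Poly_Mapping.single m c) = (\<lambda>x. c * monom_eval m x)"
    by (auto simp: poly_eval_def fun_eq_iff)
  moreover have "poly_vars (Poly_Mapping.single m c) \<subseteq> V"
    using assms by (auto simp: poly_vars_def split: if_splits)
  moreover have "total_deg (Poly_Mapping.single m c) \<le> d"
    using assms by (auto simp: total_deg_le_iff split: if_splits)
  ultimately show ?thesis unfolding poly_fun_def by (auto intro!: exI)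
qed

lemma poly_eval_superset:
  assumes "finite K" "Poly_Mapping.keys p \<subseteq> K"
  shows "poly_eval p x = (\<Sum>m\<in>K. Poly_Mapping.lookup p m * monom_eval m x)"
  unfolding poly_eval_def
  by (rule sum.mono_neutral_left) (use assms in \<open>auto simp: in_keys_iff\<close>)

lemma poly_eval_add: "poly_eval (p + q) x = poly_eval p x + poly_eval q x"
proof -
  define K where "K = Poly_Mapping.keys p \<union> Poly_Mapping.keys q"
  have "finite K" by (simp add: K_def)
  moreover have "Poly_Mapping.keys (p + q) \<subseteq> K"
    unfolding K_def by (rule Poly_Mapping.keys_add)
  ultimately show ?thesis
    using poly_eval_superset[of K p x] poly_eval_superset[of K q x] poly_eval_superset[of K "p + q" x]
    by (simp add: K_def lookup_add sum.distrib algebra_simps)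
qed

lemma poly_fun_add:
  assumes "f \<in> poly_fun V d" "g \<in> poly_fun V d"
  shows "(\<lambda>x. f x + g x) \<in> poly_fun V d"
proof -
  obtain p q where p: "f = poly_eval p" "poly_vars p \<subseteq> V" "total_deg p \<le> d"
    and q: "g = poly_eval q" "poly_vars q \<subseteq> V" "total_deg q \<le> d"
    using assms unfolding poly_fun_def by blast
  have k: "Poly_Mapping.keys (p + q) \<subseteq> Poly_Mapping.keys p \<union> Poly_Mapping.keys q"
    by (rule Poly_Mapping.keys_add)
  have "(\<lambda>x. f x + g x) = poly_eval (p + q)"
    by (simp add: p q poly_eval_add fun_eq_iff)
  moreover have "poly_vars (p + q) \<subseteq> V"
    using k p(2) q(2) unfolding poly_vars_def by blast
  moreover have "total_deg (p + q) \<le> d"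
    using k p(3) q(3) unfolding total_deg_le_iff by blast
  ultimately show ?thesis unfolding poly_fun_def by blast
qed

lemma poly_fun_const [simp]: "(\<lambda>x. c) \<in> poly_fun V d"
  using poly_fun_monom[of 0 V d c] by (simp add: mono_deg_def)

lemma poly_fun_var:
  assumes "v \<in> V" shows "(\<lambda>x. x v) \<in> poly_fun V 1"
  using poly_fun_monom[of "Poly_Mapping.single v 1" V 1 1] assms by (simp add: mono_deg_def)

lemma poly_fun_sum:
  "(\<And>i. i \<in> I \<Longrightarrow> f i \<in> poly_fun V d) \<Longrightarrow> (\<lambda>x. \<Sum>i\<in>I. f i x) \<in> poly_fun V d"
  by (induction I rule: infinite_finite_induct) (auto intro: poly_fun_add)

lemma keys_add_nat:
  "Poly_Mapping.keys (m + m' :: 'v \<Rightarrow>\<^sub>0 nat) = Poly_Mapping.keys m \<union> Poly_Mapping.keys m'"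
  by (auto simp: in_keys_iff lookup_add)

lemma monom_eval_superset:
  assumes "finite K" "Poly_Mapping.keys m \<subseteq> K"
  shows "monom_eval m x = (\<Prod>v\<in>K. x v ^ Poly_Mapping.lookup m v)"
  by (rule prod.mono_neutral_left) (use assms in \<open>auto simp: in_keys_iff\<close>)

lemma mono_deg_superset:
  assumes "finite K" "Poly_Mapping.keys m \<subseteq> K"
  shows "mono_deg m = (\<Sum>v\<in>K. Poly_Mapping.lookup m v)"
  unfolding mono_deg_def
  by (rule sum.mono_neutral_left) (use assms in \<open>auto simp: in_keys_iff\<close>)

lemma monom_eval_add: "monom_eval (m + m') x = monom_eval m x * monom_eval m' x"
proof -
  define K where "K = Poly_Mapping.keys m \<union> Poly_Mapping.keys m'"
  have K: "finite K" "Poly_Mapping.keys m \<subseteq> K" "Poly_Mapping.keys m' \<subseteq> K"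
    "Poly_Mapping.keys (m + m') \<subseteq> K"
    by (auto simp: K_def keys_add_nat)
  show ?thesis
    unfolding monom_eval_superset[OF K(1) K(2)] monom_eval_superset[OF K(1) K(3)]
      monom_eval_superset[OF K(1) K(4)]
    by (simp add: lookup_add power_add prod.distrib)
qed

lemma mono_deg_add: "mono_deg (m + m') = mono_deg m + mono_deg m'"
proof -
  define K where "K = Poly_Mapping.keys m \<union> Poly_Mapping.keys m'"
  have K: "finite K" "Poly_Mapping.keys m \<subseteq> K" "Poly_Mapping.keys m' \<subseteq> K"
    "Poly_Mapping.keys (m + m') \<subseteq> K"
    by (auto simp: K_def keys_add_nat)
  show ?thesis
    unfolding mono_deg_superset[OF K(1) K(2)] mono_deg_superset[OF K(1) K(3)]
      mono_deg_superset[OF K(1) K(4)]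
    by (simp add: lookup_add sum.distrib)
qed

lemma poly_fun_mult:
  assumes "f \<in> poly_fun V d" "g \<in> poly_fun V e"
  shows "(\<lambda>x. f x * g x) \<in> poly_fun V (d + e)"
proof -
  obtain p q where p: "f = poly_eval p" "poly_vars p \<subseteq> V" "total_deg p \<le> d"
    and q: "g = poly_eval q" "poly_vars q \<subseteq> V" "total_deg q \<le> e"
    using assms unfolding poly_fun_def by blast
  have "(\<lambda>x. f x * g x) = (\<lambda>x. \<Sum>m\<in>Poly_Mapping.keys p. \<Sum>m'\<in>Poly_Mapping.keys q.
      (Poly_Mapping.lookup p m * Poly_Mapping.lookup q m') * monom_eval (m + m') x)"
    unfolding p q poly_eval_def sum_product monom_eval_add by (simp add: algebra_simps)
  also have "\<dots> \<in> poly_fun V (d + e)"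
  proof (intro poly_fun_sum poly_fun_monom)
    fix m m' assume m: "m \<in> Poly_Mapping.keys p" "m' \<in> Poly_Mapping.keys q"
    show "Poly_Mapping.keys (m + m') \<subseteq> V"
      using m p(2) q(2) by (auto simp: keys_add_nat poly_vars_def)
    show "mono_deg (m + m') \<le> d + e"
      using m p(3) q(3) by (auto simp: mono_deg_add total_deg_le_iff intro: add_mono)
  qed
  finally show ?thesis .
qed

lemma poly_fun_scale: "f \<in> poly_fun V d \<Longrightarrow> (\<lambda>x. c * f x) \<in> poly_fun V d"
  using poly_fun_mult[of "\<lambda>x. c" V 0 f d] by simp

lemma poly_fun_uminus: "f \<in> poly_fun V d \<Longrightarrow> (\<lambda>x. - f x) \<in> poly_fun V d"
  using poly_fun_scale[of f V d "-1"] by simp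

lemma poly_fun_diff:
  "f \<in> poly_fun V d \<Longrightarrow> g \<in> poly_fun V d \<Longrightarrow> (\<lambda>x. f x - g x) \<in> poly_fun V d"
  using poly_fun_add[of f V d "\<lambda>x. - g x"] poly_fun_uminus[of g V d] by simp

lemma poly_fun_prod:
  assumes "finite I" "\<And>i. i \<in> I \<Longrightarrow> f i \<in> poly_fun V d"
  shows "(\<lambda>x. \<Prod>i\<in>I. f i x) \<in> poly_fun V (card I * d)"
  using assms
proof (induction I rule: finite_induct)
  case (insert i I)
  have "(\<lambda>x. f i x * (\<Prod>i\<in>I. f i x)) \<in> poly_fun V (d + card I * d)"
    using insert by (intro poly_fun_mult) auto
  then show ?case using insert(1,2) by simp
qed simp

lemma rdeg_le:
  assumes "p \<in> poly_fun V d" "q \<in> poly_fun V d" "\<And>z. z \<in> Z \<Longrightarrow> q z \<noteq> 0"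
    and "\<And>z. z \<in> Z \<Longrightarrow> \<bar>h z - p z / q z\<bar> \<le> \<epsilon>"
  shows "rdeg V Z h \<epsilon> \<le> d"
proof -
  obtain P Q where P: "p = poly_eval P" "poly_vars P \<subseteq> V" "total_deg P \<le> d"
    and Q: "q = poly_eval Q" "poly_vars Q \<subseteq> V" "total_deg Q \<le> d"
    using assms(1,2) unfolding poly_fun_def by blast
  have "rdeg V Z h \<epsilon> \<le> max (total_deg P) (total_deg Q)"
    unfolding rdeg_def
    by (rule Least_le) (use P Q assms(3,4) in blast)
  then show ?thesis using P Q by linarith
qed

lemma rdeg_attained:
  assumes "p \<in> poly_fun V d" "q \<in> poly_fun V d" "\<And>z. z \<in> Z \<Longrightarrow> q z \<noteq> 0"
    and "\<And>z. z \<in> Z \<Longrightarrow> \<bar>h z - p z / q z\<bar> \<le> \<epsilon>"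
  shows "\<exists>p'\<in>poly_fun V (rdeg V Z h \<epsilon>). \<exists>q'\<in>poly_fun V (rdeg V Z h \<epsilon>).
    (\<forall>z\<in>Z. q' z \<noteq> 0) \<and> (\<forall>z\<in>Z. \<bar>h z - p' z / q' z\<bar> \<le> \<epsilon>)"
proof -
  let ?A = "\<lambda>d. \<exists>p q. poly_vars p \<subseteq> V \<and> poly_vars q \<subseteq> V \<and>
     (\<forall>z\<in>Z. poly_eval q z \<noteq> 0) \<and>
     (\<forall>z\<in>Z. \<bar>h z - poly_eval p z / poly_eval q z\<bar> \<le> \<epsilon>) \<and>
     d = max (total_deg p) (total_deg q)"
  obtain P Q where P: "p = poly_eval P" "poly_vars P \<subseteq> V" "total_deg P \<le> d"
    and Q: "q = poly_eval Q" "poly_vars Q \<subseteq> V" "total_deg Q \<le> d"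
    using assms(1,2) unfolding poly_fun_def by blast
  have "?A (max (total_deg P) (total_deg Q))" using P Q assms(3,4) by blast
  then have "?A (rdeg V Z h \<epsilon>)" unfolding rdeg_def by (rule LeastI)
  then obtain p q where pq: "poly_vars p \<subseteq> V" "poly_vars q \<subseteq> V"
     "\<forall>z\<in>Z. poly_eval q z \<noteq> 0"
     "\<forall>z\<in>Z. \<bar>h z - poly_eval p z / poly_eval q z\<bar> \<le> \<epsilon>"
     "rdeg V Z h \<epsilon> = max (total_deg p) (total_deg q)" by blast
  show ?thesis
    by (intro bexI[of _ "poly_eval p"] bexI[of _ "poly_eval q"]) (use pq in \<open>auto simp: poly_fun_def\<close>)
qed

section \<open>Upper bounds\<close>

lemma newman_factor_bound:
  fixes K x :: real
  assumes "K > 1" "1 \<le> x" "x \<le> K ^ D" "D \<ge> 1"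
  defines "A \<equiv> \<lambda>x. \<Prod>i<D. x + K ^ i"
  shows "A x > 0" "\<bar>A (- x)\<bar> \<le> (K - 1) / (K + 1) * A x"
proof -
  have pos: "x + K ^ i > 0" for i using assms(1,2) by (simp add: add_pos_pos)
  then show Apos: "A x > 0" unfolding A_def by (simp add: prod_pos)
  have "\<exists>i<D. K ^ i \<le> x \<and> x \<le> K ^ Suc i"
    using assms(3,4)
  proof (induction D)
    case (Suc D)
    show ?case
    proof (cases "x \<le> K ^ D \<and> D \<ge> 1")
      case True then show ?thesis using Suc.IH less_Suc_eq by blast
    next
      case False
      then have "K ^ D \<le> x" using assms(2) by (cases D) auto
      then show ?thesis using Suc.prems by blast
    qed
  qed simp
  then obtain i where i: "i < D" "K ^ i \<le> x" "x \<le> K ^ Suc i" by blast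
  have "\<bar>A (- x)\<bar> = \<bar>- x + K ^ i\<bar> * (\<Prod>k\<in>{..<D}-{i}. \<bar>- x + K ^ k\<bar>)"
    unfolding A_def abs_prod by (rule prod.remove) (use i in auto)
  also have "\<dots> \<le> ((K - 1) / (K + 1) * (x + K ^ i)) * (\<Prod>k\<in>{..<D}-{i}. x + K ^ k)"
  proof (intro mult_mono prod_mono prod_nonneg conjI ballI)
    have "(x - K ^ i) * (K + 1) \<le> (K - 1) * (x + K ^ i)"
      using i(3) by (simp add: algebra_simps)
    then show "\<bar>- x + K ^ i\<bar> \<le> (K - 1) / (K + 1) * (x + K ^ i)"
      using i(2) assms(1) by (simp add: field_simps)
    show "\<bar>- x + K ^ k\<bar> \<le> x + K ^ k" for k using assms(1,2) by (simp add: abs_le_iff)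
    show "0 \<le> (K - 1) / (K + 1) * (x + K ^ i)" using assms(1) pos[of i] by simp
  qed auto
  also have "\<dots> = (K - 1) / (K + 1) * ((x + K ^ i) * (\<Prod>k\<in>{..<D}-{i}. x + K ^ k))" by simp
  also have "(x + K ^ i) * (\<Prod>k\<in>{..<D}-{i}. x + K ^ k) = A x"
    unfolding A_def by (rule prod.remove[symmetric]) (use i in auto)
  finally show "\<bar>A (- x)\<bar> \<le> (K - 1) / (K + 1) * A x" .
qed

lemma newman_sign_approx:
  fixes K x :: real
  assumes K: "K > 1" and x: "1 \<le> \<bar>x\<bar>" "\<bar>x\<bar> \<le> K ^ D" and "D \<ge> 1"
    and eps: "0 < \<epsilon>" "\<epsilon> < 1" "K\<^sup>2 * (1 - \<epsilon>) = 1 + \<epsilon>"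
  defines "A \<equiv> \<lambda>x. \<Prod>i<D. x + K ^ i"
  shows "A x + A (- x) \<noteq> 0"
    "\<bar>sgn x - (K * (1 - \<epsilon>)) * (A x - A (- x)) / (A x + A (- x))\<bar> \<le> \<epsilon>"
proof -
  have main: "A y + A (- y) > 0 \<and> \<bar>1 - (K * (1 - \<epsilon>)) * (A y - A (- y)) / (A y + A (- y))\<bar> \<le> \<epsilon>"
    if y: "1 \<le> y" "y \<le> K ^ D" for y
  proof -
    have a: "A y > 0" and b: "\<bar>A (- y)\<bar> \<le> (K - 1) / (K + 1) * A y"
      using newman_factor_bound[OF K y \<open>D \<ge> 1\<close>] unfolding A_def by auto
    have "\<bar>A (- y)\<bar> * (K + 1) \<le> (K - 1) * A y"
      using b K by (simp add: field_simps)
    then have c: "A (- y) * (K + 1) \<le> (K - 1) * A y" "- A (- y) * (K + 1) \<le> (K - 1) * A y"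
      using K by (smt (verit, best) mult_right_mono)+
    have p: "A y + A (- y) > 0"
    proof (rule ccontr)
      assume "\<not> ?thesis"
      then have "A y * (K + 1) \<le> - A (- y) * (K + 1)" using K by (intro mult_right_mono) auto
      then show False using c(2) a by (simp add: algebra_simps)
    qed
    have l: "(A y + A (- y)) \<le> K * (A y - A (- y))" using c(1) by (simp add: algebra_simps)
    have u: "A y - A (- y) \<le> K * (A y + A (- y))" using c(2) by (simp add: algebra_simps)
    have "(1 - \<epsilon>) * (A y + A (- y)) \<le> (1 - \<epsilon>) * (K * (A y - A (- y)))"
      using l eps by (intro mult_left_mono) auto
    moreover have "K * (1 - \<epsilon>) * (A y - A (- y)) \<le> K * (1 - \<epsilon>) * (K * (A y + A (- y)))"
      using u eps K by (intro mult_left_mono) auto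
    moreover have "K * (1 - \<epsilon>) * (K * (A y + A (- y))) = (1 + \<epsilon>) * (A y + A (- y))"
      unfolding eps(3)[symmetric] by (simp add: power2_eq_square)
    ultimately have "(1 - \<epsilon>) * (A y + A (- y)) \<le> (K * (1 - \<epsilon>)) * (A y - A (- y))"
      "(K * (1 - \<epsilon>)) * (A y - A (- y)) \<le> (1 + \<epsilon>) * (A y + A (- y))"
      by (simp_all only: mult_ac)
    then have "1 - \<epsilon> \<le> (K * (1 - \<epsilon>)) * (A y - A (- y)) / (A y + A (- y))"
      "(K * (1 - \<epsilon>)) * (A y - A (- y)) / (A y + A (- y)) \<le> 1 + \<epsilon>"
      unfolding pos_le_divide_eq[OF p] pos_divide_le_eq[OF p] .
    then show ?thesis using p by linarith
  qed
  have "A x + A (- x) \<noteq> 0 \<and> \<bar>sgn x - (K * (1 - \<epsilon>)) * (A x - A (- x)) / (A x + A (- x))\<bar> \<le> \<epsilon>"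
  proof (cases "x > 0")
    case True then show ?thesis using main[of x] x by auto
  next
    case False
    define w where "w = (K * (1 - \<epsilon>)) * (A (- x) - A x) / (A (- x) + A x)"
    have w: "A (- x) + A x > 0" "\<bar>1 - w\<bar> \<le> \<epsilon>"
      using main[of "- x"] x False unfolding w_def by auto
    have "(K * (1 - \<epsilon>)) * (A x - A (- x)) / (A x + A (- x)) = - w"
      unfolding w_def minus_divide_left by (simp add: algebra_simps)
    moreover have "sgn x = -1" using False x by (simp add: sgn_if)
    ultimately show ?thesis using w by auto
  qed
  then show "A x + A (- x) \<noteq> 0"
    "\<bar>sgn x - (K * (1 - \<epsilon>)) * (A x - A (- x)) / (A x + A (- x))\<bar> \<le> \<epsilon>" by auto
qed

definition row_sum :: "nat \<Rightarrow> nat \<Rightarrow> (nat \<times> nat \<Rightarrow> real) \<Rightarrow> real" where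
  "row_sum n i x = (if i = 0 then 1 else \<Sum>j=1..n. x (i, j))"

definition tail_sum :: "nat \<Rightarrow> nat \<Rightarrow> (nat \<times> nat \<Rightarrow> real) \<Rightarrow> real" where
  "tail_sum n k x = (\<Sum>i=k..n. 2 ^ (i - k) * row_sum n i x)"

lemma tail_sum_Suc:
  assumes "k \<le> n" shows "tail_sum n k x = row_sum n k x + 2 * tail_sum n (Suc k) x"
proof -
  have "tail_sum n k x = row_sum n k x + (\<Sum>i=Suc k..n. 2 ^ (i - k) * row_sum n i x)"
    unfolding tail_sum_def using assms by (simp add: sum.atLeast_Suc_atMost)
  also have "(\<Sum>i=Suc k..n. 2 ^ (i - k) * row_sum n i x) = 2 * tail_sum n (Suc k) x"
    unfolding tail_sum_def sum_distrib_left
    by (rule sum.cong) (auto simp: Suc_diff_le power_Suc[symmetric] mult.assoc[symmetric] Suc_diff_Suc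
        simp del: power_Suc)
  finally show ?thesis .
qed

lemma halfspace_tail_sum: "halfspace n x = sgn (tail_sum n 0 x)"
proof -
  have "tail_sum n 0 x = 1 + (\<Sum>i=1..n. 2 ^ i * row_sum n i x)"
    unfolding tail_sum_def by (simp add: sum.atLeast_Suc_atMost row_sum_def)
  also have "\<dots> = 1 + (\<Sum>i=1..n. \<Sum>j=1..n. 2 ^ i * x (i, j))"
    by (simp add: row_sum_def sum_distrib_left)
  finally show ?thesis unfolding halfspace_def by simp
qed

lemma sign_cube_cases: "x \<in> sign_cube V \<Longrightarrow> v \<in> V \<Longrightarrow> x v = -1 \<or> x v = 1"
  unfolding sign_cube_def by (auto simp: PiE_iff)

lemma finite_sign_cube [simp]: "finite V \<Longrightarrow> finite (sign_cube V)"
  unfolding sign_cube_def by (simp add: finite_PiE)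

lemma finite_grid [simp]: "finite (grid n)"
  unfolding grid_def by simp

lemma tail_sum_Ints:
  assumes "x \<in> sign_cube (grid n)" shows "tail_sum n k x \<in> \<int>"
proof -
  have "row_sum n i x \<in> \<int>" if "i \<le> n" for i
  proof (cases "i = 0")
    case False
    have "x (i, j) \<in> \<int>" if "j \<in> {1..n}" for j
      using sign_cube_cases[OF assms, of "(i, j)"] that False \<open>i \<le> n\<close> by (auto simp: grid_def)
    then show ?thesis by (auto simp: row_sum_def)
  qed (simp add: row_sum_def)
  then show ?thesis unfolding tail_sum_def by (auto intro!: Ints_sum Ints_mult)
qed

lemma abs_row_sum_le:
  assumes "x \<in> sign_cube (grid n)" "i \<le> n" "n \<ge> 1" shows "\<bar>row_sum n i x\<bar> \<le> n"
proof (cases "i = 0")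
  case False
  have "\<bar>x (i, j)\<bar> \<le> 1" if "j \<in> {1..n}" for j
    using sign_cube_cases[OF assms(1), of "(i, j)"] that False \<open>i \<le> n\<close> by (auto simp: grid_def)
  then have "(\<Sum>j=1..n. \<bar>x (i, j)\<bar>) \<le> (\<Sum>j=1..n. 1)" by (intro sum_mono)
  then have "\<bar>\<Sum>j=1..n. x (i, j)\<bar> \<le> (\<Sum>j=1..n. 1)" by (rule order_trans[OF sum_abs])
  then show ?thesis using False by (simp add: row_sum_def)
qed (use assms in \<open>simp add: row_sum_def\<close>)

lemma abs_tail_sum_0_ge:
  assumes "x \<in> sign_cube (grid n)" shows "\<bar>tail_sum n 0 x\<bar> \<ge> 1"
proof -
  obtain m where "tail_sum n 1 x = of_int m" using tail_sum_Ints[OF assms] by (auto elim: Ints_cases)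
  then have "tail_sum n 0 x = of_int (1 + 2 * m)"
    by (simp add: tail_sum_Suc row_sum_def)
  moreover have "\<bar>1 + 2 * m\<bar> \<ge> 1" by presburger
  ultimately show ?thesis by (metis of_int_1_le_iff of_int_abs)
qed

lemma abs_tail_sum_0_le:
  assumes "x \<in> sign_cube (grid n)" "n \<ge> 1" shows "\<bar>tail_sum n 0 x\<bar> \<le> 2 ^ (3 * n)"
proof -
  have "\<bar>tail_sum n 0 x\<bar> \<le> (\<Sum>i=0..n. \<bar>2 ^ i * row_sum n i x\<bar>)"
    unfolding tail_sum_def by (rule order_trans[OF sum_abs]) simp
  also have "\<dots> \<le> (\<Sum>i=0..n. 2 ^ i * real n)"
    by (intro sum_mono) (use abs_row_sum_le[OF assms(1) _ assms(2)] in \<open>simp add: abs_mult\<close>)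
  also have "\<dots> = (\<Sum>i=0..n. 2 ^ i) * real n" by (simp add: sum_distrib_right)
  also have "(\<Sum>i=0..n. 2 ^ i :: real) = 2 ^ Suc n - 1"
    using sum_gp[of "2::real" 0 n] by (simp add: atLeast0AtMost)
  also have "(2 ^ Suc n - 1) * real n \<le> 2 ^ Suc n * 2 ^ n"
    by (intro mult_mono) (auto simp: of_nat_less_two_power less_imp_le)
  also have "\<dots> = 2 ^ (Suc n + n)" by (simp add: power_add)
  also have "\<dots> \<le> 2 ^ (3 * n)" using assms(2) by (intro power_increasing) auto
  finally show ?thesis .
qed

lemma poly_fun_tail_sum: "tail_sum n k \<in> poly_fun (grid n) 1"
proof -
  have "row_sum n i \<in> poly_fun (grid n) 1" if "i \<in> {k..n}" for i
    using that unfolding row_sum_def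
    by (cases "i = 0") (auto intro!: poly_fun_sum poly_fun_var[unfolded One_nat_def] simp: grid_def)
  then have "(\<lambda>x. \<Sum>i=k..n. 2 ^ (i - k) * row_sum n i x) \<in> poly_fun (grid n) 1"
    by (intro poly_fun_sum poly_fun_scale) auto
  then show ?thesis by (simp add: tail_sum_def[abs_def])
qed

lemma rdeg_halfspace_upper:
  assumes "n \<ge> 1" "0 < \<epsilon>" "\<epsilon> < 1"
  shows "real (rdeg (grid n) (sign_cube (grid n)) (halfspace n) \<epsilon>)
    \<le> 6 * (1 + real n / log 2 (1 / (1 - \<epsilon>)))"
proof -
  define l where "l = log 2 (1 / (1 - \<epsilon>))"
  define K where "K = sqrt ((1 + \<epsilon>) / (1 - \<epsilon>))"
  have "1 / (1 - \<epsilon>) > 1" using assms by simp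
  then have l: "l > 0" unfolding l_def using assms by (subst zero_less_log_cancel_iff) auto
  have K1: "K > 1" unfolding K_def using assms by simp
  have K2: "K\<^sup>2 = (1 + \<epsilon>) / (1 - \<epsilon>)" unfolding K_def using assms by simp
  have "l \<le> log 2 (K\<^sup>2)" unfolding l_def K2 using assms by (simp add: divide_right_mono)
  also have "\<dots> = 2 * log 2 K" using K1 by (simp add: log_nat_power)
  finally have lK: "l \<le> 2 * log 2 K" .
  define D where "D = nat \<lceil>3 * n / log 2 K\<rceil>"
  have Kp: "log 2 K > 0" using l lK by simp
  have q: "3 * n / log 2 K > 0" using Kp assms(1) by simp
  then have D1: "D \<ge> 1" unfolding D_def by linarith
  have Dge: "real D \<ge> 3 * n / log 2 K" unfolding D_def using q by linarith
  have "real D \<le> 3 * n / log 2 K + 1" unfolding D_def using q by linarith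
  also have "3 * n / log 2 K \<le> 3 * n / (l / 2)"
    using l lK by (intro divide_left_mono) auto
  finally have Dle: "real D \<le> 6 * (1 + n / l)" by (simp add: algebra_simps)
  have "2 ^ (3 * n) = 2 powr (3 * n)" by (subst powr_realpow[symmetric]) auto
  also have "\<dots> \<le> 2 powr (log 2 K * D)" using Dge Kp by (simp add: field_simps)
  also have "\<dots> = K ^ D" using K1 by (simp add: powr_powr[symmetric] powr_realpow)
  finally have KD: "2 ^ (3 * n) \<le> K ^ D" .
  define A where "A = (\<lambda>y::real. \<Prod>i<D. y + K ^ i)"
  have A1: "(\<lambda>x. A (tail_sum n 0 x)) \<in> poly_fun (grid n) D"
    using poly_fun_prod[of "{..<D}" "\<lambda>i x. tail_sum n 0 x + K ^ i" "grid n" 1,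
        OF _ poly_fun_add[OF poly_fun_tail_sum poly_fun_const]]
    by (simp add: A_def)
  have A2: "(\<lambda>x. A (- tail_sum n 0 x)) \<in> poly_fun (grid n) D"
    using poly_fun_prod[of "{..<D}" "\<lambda>i x. - tail_sum n 0 x + K ^ i" "grid n" 1,
        OF _ poly_fun_add[OF poly_fun_uminus[OF poly_fun_tail_sum] poly_fun_const]]
    by (simp add: A_def)
  have "rdeg (grid n) (sign_cube (grid n)) (halfspace n) \<epsilon> \<le> D"
  proof (rule rdeg_le)
    show "(\<lambda>x. (K * (1 - \<epsilon>)) * (A (tail_sum n 0 x) - A (- tail_sum n 0 x))) \<in> poly_fun (grid n) D"
      by (intro poly_fun_scale poly_fun_diff A1 A2)
    show "(\<lambda>x. A (tail_sum n 0 x) + A (- tail_sum n 0 x)) \<in> poly_fun (grid n) D"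
      by (intro poly_fun_add A1 A2)
    fix x assume x: "x \<in> sign_cube (grid n)"
    have b: "1 \<le> \<bar>tail_sum n 0 x\<bar>" "\<bar>tail_sum n 0 x\<bar> \<le> K ^ D"
      using abs_tail_sum_0_ge[OF x] abs_tail_sum_0_le[OF x assms(1)] KD by auto
    have e: "K\<^sup>2 * (1 - \<epsilon>) = 1 + \<epsilon>" using K2 assms by simp
    note N = newman_sign_approx[OF K1 b D1 assms(2,3) e]
    show "A (tail_sum n 0 x) + A (- tail_sum n 0 x) \<noteq> 0" unfolding A_def by (rule N)
    show "\<bar>halfspace n x - (K * (1 - \<epsilon>)) * (A (tail_sum n 0 x) - A (- tail_sum n 0 x)) /
        (A (tail_sum n 0 x) + A (- tail_sum n 0 x))\<bar> \<le> \<epsilon>"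
      unfolding halfspace_tail_sum A_def by (rule N)
  qed
  then show ?thesis using Dle unfolding l_def by linarith
qed

lemma dominant_level:
  fixes \<alpha> \<beta> :: "nat \<Rightarrow> real"
  assumes ab: "\<And>k. \<bar>\<alpha> k\<bar> \<le> \<beta> k" and "\<kappa> \<le> n" "\<beta> \<kappa> > 0" "\<alpha> \<kappa> = \<sigma> * \<beta> \<kappa>" "\<bar>\<sigma>\<bar> = 1"
    and zero: "\<And>k. \<kappa> < k \<Longrightarrow> k \<le> n \<Longrightarrow> \<beta> k = 0" and "\<epsilon> > 0"
  shows "\<forall>\<^sub>F M in at_top. (\<Sum>k\<le>n. M ^ k * \<beta> k) \<noteq> 0 \<and>
    \<bar>\<sigma> - (\<Sum>k\<le>n. M ^ k * \<alpha> k) / (\<Sum>k\<le>n. M ^ k * \<beta> k)\<bar> \<le> \<epsilon>"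
  using eventually_ge_at_top[of "max 1 (2 * (\<Sum>k\<le>n. \<beta> k) / (\<epsilon> * \<beta> \<kappa>))"]
proof eventually_elim
  case (elim M)
  have b0: "\<beta> k \<ge> 0" for k using ab[of k] by linarith
  have M1: "M \<ge> 1" and M2: "2 * (\<Sum>k\<le>n. \<beta> k) \<le> M * (\<epsilon> * \<beta> \<kappa>)"
    using elim \<open>\<epsilon> > 0\<close> \<open>\<beta> \<kappa> > 0\<close> by (auto simp: field_simps)
  define q where "q = (\<Sum>k\<le>n. M ^ k * \<beta> k)"
  define p where "p = (\<Sum>k\<le>n. M ^ k * \<alpha> k)"
  have q: "q \<ge> M ^ \<kappa> * \<beta> \<kappa>" unfolding q_def
    by (rule member_le_sum[where f = "\<lambda>k. M ^ k * \<beta> k"]) (use \<open>\<kappa> \<le> n\<close> b0 M1 in auto)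
  have pos: "M ^ \<kappa> * \<beta> \<kappa> > 0" using M1 \<open>\<beta> \<kappa> > 0\<close> by simp
  have "M * \<bar>\<sigma> * q - p\<bar> = M * \<bar>\<Sum>k\<le>n. M ^ k * (\<sigma> * \<beta> k - \<alpha> k)\<bar>"
    unfolding q_def p_def by (simp add: sum_distrib_left sum_subtractf algebra_simps)
  also have "\<dots> \<le> M * (\<Sum>k\<le>n. \<bar>M ^ k * (\<sigma> * \<beta> k - \<alpha> k)\<bar>)"
    using M1 by (intro mult_left_mono sum_abs) auto
  also have "\<dots> = (\<Sum>k\<le>n. M * \<bar>M ^ k * (\<sigma> * \<beta> k - \<alpha> k)\<bar>)" by (simp add: sum_distrib_left)
  also have "\<dots> \<le> (\<Sum>k\<le>n. M ^ \<kappa> * (2 * \<beta> k))"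
  proof (rule sum_mono)
    fix k assume k: "k \<in> {..n}"
    have d: "\<bar>\<sigma> * \<beta> k - \<alpha> k\<bar> \<le> 2 * \<beta> k"
      using abs_triangle_ineq4[of "\<sigma> * \<beta> k" "\<alpha> k"] ab[of k] b0[of k] \<open>\<bar>\<sigma>\<bar> = 1\<close> by (simp add: abs_mult)
    show "M * \<bar>M ^ k * (\<sigma> * \<beta> k - \<alpha> k)\<bar> \<le> M ^ \<kappa> * (2 * \<beta> k)"
    proof (cases "k < \<kappa>")
      case True
      have "M * \<bar>M ^ k * (\<sigma> * \<beta> k - \<alpha> k)\<bar> = M ^ Suc k * \<bar>\<sigma> * \<beta> k - \<alpha> k\<bar>"
        using M1 by (simp add: abs_mult)
      also have "\<dots> \<le> M ^ \<kappa> * (2 * \<beta> k)"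
        using True M1 d by (intro mult_mono power_increasing) auto
      finally show ?thesis .
    next
      case False
      then have "\<sigma> * \<beta> k - \<alpha> k = 0"
        using zero[of k] k ab[of k] \<open>\<alpha> \<kappa> = \<sigma> * \<beta> \<kappa>\<close> by (cases "k = \<kappa>") auto
      then show ?thesis using b0[of k] M1 by simp
    qed
  qed
  also have "\<dots> = M ^ \<kappa> * (2 * (\<Sum>k\<le>n. \<beta> k))" by (simp add: sum_distrib_left algebra_simps)
  also have "\<dots> \<le> M ^ \<kappa> * (M * (\<epsilon> * \<beta> \<kappa>))" using M1 M2 by (intro mult_left_mono) auto
  also have "\<dots> = M * (\<epsilon> * (M ^ \<kappa> * \<beta> \<kappa>))" by (simp add: algebra_simps)
  also have "\<dots> \<le> M * (\<epsilon> * q)" using q M1 \<open>\<epsilon> > 0\<close> by (intro mult_left_mono) auto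
  finally have "\<bar>\<sigma> * q - p\<bar> \<le> \<epsilon> * q" using M1 by simp
  moreover have "\<sigma> - p / q = (\<sigma> * q - p) / q" using pos q by (simp add: field_simps)
  ultimately have "\<bar>\<sigma> - p / q\<bar> \<le> \<epsilon>" using pos q by (simp add: pos_divide_le_eq)
  then show ?case using pos q unfolding p_def q_def by auto
qed

definition threshold :: "nat \<Rightarrow> nat \<Rightarrow> int" where
  "threshold n k = (if k = 0 then 1 else int n)"

text \<open>Vanishes at the integers of \<open>[-3 n, 3 n]\<close> below the threshold, and only there.\<close>

definition above :: "nat \<Rightarrow> nat \<Rightarrow> real \<Rightarrow> real" where
  "above n k t = (\<Prod>r\<in>{- 3 * int n..threshold n k - 1}. (t - of_int r)\<^sup>2)"

lemma above_nonneg: "above n k t \<ge> 0"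
  unfolding above_def by (rule prod_nonneg) simp

lemma above_eq_0:
  "- 3 * int n \<le> t \<Longrightarrow> t < threshold n k \<Longrightarrow> above n k (of_int t) = 0"
  unfolding above_def by (subst prod_zero_iff) auto

lemma above_pos:
  "t \<ge> threshold n k \<Longrightarrow> above n k (of_int t) > 0"
  unfolding above_def by (rule prod_pos) auto

lemma poly_fun_above:
  assumes "l \<in> poly_fun V 1" "n \<ge> 1" shows "(\<lambda>x. above n k (l x)) \<in> poly_fun V (8 * n)"
proof -
  have "(\<lambda>x. (l x - of_int r)\<^sup>2) \<in> poly_fun V 2" for r
  proof -
    have "(\<lambda>x. (l x - of_int r) * (l x - of_int r)) \<in> poly_fun V (1 + 1)"
      by (intro poly_fun_mult poly_fun_diff assms poly_fun_const)
    then show ?thesis by (simp add: power2_eq_square numeral_2_eq_2)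
  qed
  then have "(\<lambda>x. above n k (l x)) \<in> poly_fun V (card {- 3 * int n..threshold n k - 1} * 2)"
    unfolding above_def by (intro poly_fun_prod) auto
  then show ?thesis
    by (rule poly_fun_mono) (use assms(2) in \<open>auto simp: threshold_def\<close>)
qed

lemma tail_sum_sign_stable:
  assumes x: "x \<in> sign_cube (grid n)" and "n \<ge> 1" "k \<le> n" "\<sigma> = 1 \<or> \<sigma> = -1" "\<sigma> * tail_sum n k x \<ge> n"
  shows "\<sigma> * tail_sum n 0 x \<ge> n"
  using assms(3,5)
proof (induction k)
  case (Suc k)
  have "tail_sum n k x = row_sum n k x + 2 * tail_sum n (Suc k) x"
    using Suc.prems by (intro tail_sum_Suc) auto
  then have "\<sigma> * tail_sum n k x = \<sigma> * row_sum n k x + 2 * (\<sigma> * tail_sum n (Suc k) x)"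
    by (simp add: algebra_simps)
  moreover have "\<bar>\<sigma> * row_sum n k x\<bar> \<le> n"
    using abs_row_sum_le[OF x _ assms(2), of k] Suc.prems assms(4) by (auto simp: abs_mult)
  ultimately have "\<sigma> * tail_sum n k x \<ge> n" using Suc.prems by linarith
  then show ?case using Suc by simp
qed simp

lemma halfspace_rational_approx:
  assumes n: "n \<ge> 1" and "\<epsilon> > 0"
  obtains p q where "p \<in> poly_fun (grid n) (8 * n)" "q \<in> poly_fun (grid n) (8 * n)"
    "\<And>x. x \<in> sign_cube (grid n) \<Longrightarrow> q x \<noteq> 0"
    "\<And>x. x \<in> sign_cube (grid n) \<Longrightarrow> \<bar>halfspace n x - p x / q x\<bar> \<le> \<epsilon>"
proof -
  define \<alpha> where "\<alpha> = (\<lambda>x k. above n k (tail_sum n k x) - above n k (- tail_sum n k x))"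
  define \<beta> where "\<beta> = (\<lambda>x k. above n k (tail_sum n k x) + above n k (- tail_sum n k x))"
  define p where "p = (\<lambda>M x. \<Sum>k\<le>n. M ^ k * \<alpha> x k)"
  define q where "q = (\<lambda>M x. \<Sum>k\<le>n. M ^ k * \<beta> x k)"
  have "\<forall>\<^sub>F M in at_top. q M x \<noteq> 0 \<and> \<bar>halfspace n x - p M x / q M x\<bar> \<le> \<epsilon>"
    if x: "x \<in> sign_cube (grid n)" for x
  proof -
    define t where "t = (\<lambda>k. \<lfloor>tail_sum n k x\<rfloor>)"
    have t: "tail_sum n k x = of_int (t k)" for k
      unfolding t_def using tail_sum_Ints[OF x] by simp
    define S where "S = {k. k \<le> n \<and> \<bar>t k\<bar> \<ge> threshold n k}"
    have fin: "finite S" unfolding S_def by simp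
    have "\<bar>t 0\<bar> \<ge> 1" using abs_tail_sum_0_ge[OF x] t[of 0] by linarith
    then have "0 \<in> S" by (simp add: S_def threshold_def)
    define \<kappa> where "\<kappa> = Max S"
    have \<kappa>: "\<kappa> \<in> S" unfolding \<kappa>_def using fin \<open>0 \<in> S\<close> by (intro Max_in) auto
    have small: "\<bar>t k\<bar> < threshold n k" if "\<kappa> < k" "k \<le> n" for k
      using that Max_ge[OF fin, of k] unfolding \<kappa>_def S_def by fastforce
    have "\<bar>t (Suc \<kappa>)\<bar> \<le> n"
    proof (cases "Suc \<kappa> \<le> n")
      case True then show ?thesis using small[of "Suc \<kappa>"] by (simp add: threshold_def)
    next
      case False
      then have "tail_sum n (Suc \<kappa>) x = 0" unfolding tail_sum_def by simp
      then show ?thesis using t[of "Suc \<kappa>"] by simp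
    qed
    then have "\<bar>tail_sum n (Suc \<kappa>) x\<bar> \<le> n" using t[of "Suc \<kappa>"] by linarith
    moreover have "\<kappa> \<le> n" using \<kappa> by (simp add: S_def)
    ultimately have "\<bar>tail_sum n \<kappa> x\<bar> \<le> 3 * n"
      using tail_sum_Suc[of \<kappa> n x] abs_row_sum_le[OF x \<open>\<kappa> \<le> n\<close> n] by linarith
    then have big: "\<bar>t \<kappa>\<bar> \<le> 3 * n" using t[of \<kappa>] by linarith
    define \<sigma> :: real where "\<sigma> = sgn (tail_sum n \<kappa> x)"
    have thr: "\<bar>t \<kappa>\<bar> \<ge> threshold n \<kappa>" "threshold n \<kappa> \<ge> 1"
      using \<kappa> n by (auto simp: S_def threshold_def)
    have sig: "\<sigma> = 1 \<or> \<sigma> = -1" unfolding \<sigma>_def t using thr by (auto simp: sgn_if)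
    have "sgn (tail_sum n 0 x) = \<sigma>"
    proof (cases "\<kappa> = 0")
      case False
      have "\<sigma> * tail_sum n \<kappa> x = \<bar>tail_sum n \<kappa> x\<bar>" unfolding \<sigma>_def by (simp add: sgn_if)
      also have "\<dots> \<ge> n" using thr(1) False t[of \<kappa>] by (simp add: threshold_def)
      finally have "\<sigma> * tail_sum n 0 x \<ge> n"
        by (rule tail_sum_sign_stable[OF x n \<open>\<kappa> \<le> n\<close> sig])
      then show ?thesis using n sig by (auto simp: sgn_if)
    qed (simp add: \<sigma>_def)
    then have h: "halfspace n x = \<sigma>" unfolding halfspace_tail_sum .
    have "\<beta> x \<kappa> > 0 \<and> \<alpha> x \<kappa> = \<sigma> * \<beta> x \<kappa>"
    proof (cases "t \<kappa> > 0")
      case True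
      then have "\<sigma> = 1" by (simp add: \<sigma>_def t)
      moreover have "above n \<kappa> (tail_sum n \<kappa> x) > 0"
        unfolding t using True thr by (intro above_pos) auto
      moreover have "above n \<kappa> (- tail_sum n \<kappa> x) = 0"
        using above_eq_0[of n "- t \<kappa>" \<kappa>] True thr big by (simp add: t)
      ultimately show ?thesis by (simp add: \<alpha>_def \<beta>_def)
    next
      case False
      then have "\<sigma> = -1" using thr by (simp add: \<sigma>_def t)
      moreover have "above n \<kappa> (- tail_sum n \<kappa> x) > 0"
        using above_pos[of n \<kappa> "- t \<kappa>"] False thr by (simp add: t)
      moreover have "above n \<kappa> (tail_sum n \<kappa> x) = 0"
        unfolding t using False thr big by (intro above_eq_0) auto
      ultimately show ?thesis by (simp add: \<alpha>_def \<beta>_def)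
    qed
    moreover have "\<beta> x k = 0" if k: "\<kappa> < k" "k \<le> n" for k
    proof -
      have "\<bar>t k\<bar> < threshold n k" "threshold n k = n" using small[OF k] k by (auto simp: threshold_def)
      then show ?thesis using above_eq_0[of n "t k" k] above_eq_0[of n "- t k" k]
        by (simp add: \<beta>_def t)
    qed
    moreover have "\<bar>\<alpha> x k\<bar> \<le> \<beta> x k" for k
      unfolding \<alpha>_def \<beta>_def using above_nonneg[of n k] by (smt (verit))
    ultimately show ?thesis
      unfolding p_def q_def h using dominant_level[of "\<alpha> x" "\<beta> x" \<kappa> n \<sigma> \<epsilon>] \<open>\<kappa> \<le> n\<close> sig assms by auto
  qed
  then have "\<forall>\<^sub>F M in at_top. \<forall>x\<in>sign_cube (grid n). q M x \<noteq> 0 \<and> \<bar>halfspace n x - p M x / q M x\<bar> \<le> \<epsilon>"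
    by (intro eventually_ball_finite) auto
  then have "\<exists>M. \<forall>x\<in>sign_cube (grid n). q M x \<noteq> 0 \<and> \<bar>halfspace n x - p M x / q M x\<bar> \<le> \<epsilon>"
    by (rule eventually_happens'[OF trivial_limit_at_top_linorder])
  then obtain M where M: "\<And>x. x \<in> sign_cube (grid n) \<Longrightarrow> q M x \<noteq> 0"
     "\<And>x. x \<in> sign_cube (grid n) \<Longrightarrow> \<bar>halfspace n x - p M x / q M x\<bar> \<le> \<epsilon>"
    by blast
  have 1: "(\<lambda>x. above n k (tail_sum n k x)) \<in> poly_fun (grid n) (8 * n)" for k
    by (rule poly_fun_above[OF poly_fun_tail_sum n])
  have 2: "(\<lambda>x. above n k (- tail_sum n k x)) \<in> poly_fun (grid n) (8 * n)" for k
    by (rule poly_fun_above[OF poly_fun_uminus[OF poly_fun_tail_sum] n])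
  show ?thesis
  proof (rule that)
    show "p M \<in> poly_fun (grid n) (8 * n)"
      unfolding p_def \<alpha>_def by (intro poly_fun_sum poly_fun_scale poly_fun_diff 1 2)
    show "q M \<in> poly_fun (grid n) (8 * n)"
      unfolding q_def \<beta>_def by (intro poly_fun_sum poly_fun_scale poly_fun_add 1 2)
  qed (use M in auto)
qed

lemma rdeg_halfspace_le:
  assumes "n \<ge> 1" "\<epsilon> > 0"
  shows "int (rdeg (grid n) (sign_cube (grid n)) (halfspace n) \<epsilon>)
    \<le> 64 * int n * \<lceil>log 2 (real n)\<rceil> + 1"
proof (cases "n = 1")
  case True
  have h: "halfspace 1 x = x (1, 1)" if "x \<in> sign_cube (grid 1)" for x
    using sign_cube_cases[OF that, of "(1, 1)"] by (auto simp: halfspace_def grid_def)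
  have "rdeg (grid 1) (sign_cube (grid 1)) (halfspace 1) \<epsilon> \<le> 1"
  proof (rule rdeg_le)
    show "(\<lambda>x. x (1, 1)) \<in> poly_fun (grid 1) 1" by (intro poly_fun_var) (simp add: grid_def)
    show "(\<lambda>x. 1) \<in> poly_fun (grid 1) 1" by simp
  qed (use h assms in auto)
  then show ?thesis using True by simp
next
  case False
  have "log 2 (real n) > 0" using False assms(1) by (subst zero_less_log_cancel_iff) auto
  then have "\<lceil>log 2 (real n)\<rceil> \<ge> 1" by linarith
  then have "64 * int n * 1 \<le> 64 * int n * \<lceil>log 2 (real n)\<rceil>" by (intro mult_left_mono) auto
  moreover have "rdeg (grid n) (sign_cube (grid n)) (halfspace n) \<epsilon> \<le> 8 * n"
    using halfspace_rational_approx[OF assms] rdeg_le by metis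
  ultimately show ?thesis by linarith
qed

section \<open>The univariate lower bound\<close>

definition dominant_index :: "real poly \<Rightarrow> real \<Rightarrow> nat" where
  "dominant_index p x =
    Max {k. k \<le> degree p \<and> (\<forall>l. \<bar>coeff p l\<bar> * x ^ l \<le> \<bar>coeff p k\<bar> * x ^ k)}"

lemma dominant_index:
  fixes p :: "real poly"
  assumes "x > 0"
  shows dominant_index_le_degree: "dominant_index p x \<le> degree p"
    and dominant_index_max: "\<bar>coeff p l\<bar> * x ^ l \<le>
      \<bar>coeff p (dominant_index p x)\<bar> * x ^ dominant_index p x"
    and dominant_index_greatest: "k \<le> degree p \<Longrightarrow>
      (\<And>l. \<bar>coeff p l\<bar> * x ^ l \<le> \<bar>coeff p k\<bar> * x ^ k) \<Longrightarrow> k \<le> dominant_index p x"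
proof -
  define S where "S = {k. k \<le> degree p \<and> (\<forall>l. \<bar>coeff p l\<bar> * x ^ l \<le> \<bar>coeff p k\<bar> * x ^ k)}"
  have fin: "finite S" unfolding S_def by simp
  let ?g = "\<lambda>l. \<bar>coeff p l\<bar> * x ^ l"
  have "Max (?g ` {..degree p}) \<in> ?g ` {..degree p}" by (rule Max_in) auto
  then obtain k where k: "k \<le> degree p" "?g k = Max (?g ` {..degree p})" by force
  have "?g l \<le> ?g k" for l
  proof (cases "l \<le> degree p")
    case True then show ?thesis unfolding k(2) by (intro Max_ge) auto
  next
    case False then have "coeff p l = 0" by (simp add: coeff_eq_0)
    then show ?thesis using assms by simp
  qed
  then have "k \<in> S" using k(1) unfolding S_def by blast
  then have "Max S \<in> S" using fin by (intro Max_in) auto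
  then show "dominant_index p x \<le> degree p" "?g l \<le> ?g (dominant_index p x)"
    unfolding dominant_index_def S_def[symmetric] by (auto simp: S_def)
  show "k \<le> dominant_index p x"
    if "k \<le> degree p" "\<And>l. \<bar>coeff p l\<bar> * x ^ l \<le> \<bar>coeff p k\<bar> * x ^ k" for k
    unfolding dominant_index_def S_def[symmetric]
    by (rule Max_ge[OF fin]) (use that in \<open>auto simp: S_def\<close>)
qed

lemma dominant_index_mono:
  assumes "0 < x" "x \<le> y" shows "dominant_index p x \<le> dominant_index p y"
proof (rule ccontr)
  define k where "k = dominant_index p x"
  define m where "m = dominant_index p y"
  assume "\<not> ?thesis"
  then have less: "m < k" by (simp add: k_def m_def)
  have y: "y > 0" using assms by simp
  define r where "r = y / x"
  have r: "r \<ge> 1" "y = x * r" using assms by (auto simp: r_def)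
  have "\<bar>coeff p l\<bar> * y ^ l \<le> \<bar>coeff p k\<bar> * y ^ k" for l
  proof -
    have "\<bar>coeff p l\<bar> * y ^ l \<le> (\<bar>coeff p m\<bar> * x ^ m) * r ^ m"
      using dominant_index_max[OF y, of p l] by (simp add: m_def r(2) power_mult_distrib)
    also have "\<dots> \<le> (\<bar>coeff p k\<bar> * x ^ k) * r ^ k"
      using dominant_index_max[OF assms(1), of p m] less r assms(1)
      by (intro mult_mono[of "_ * _" _ "_ ^ _"] power_increasing) (auto simp: k_def)
    also have "\<dots> = \<bar>coeff p k\<bar> * y ^ k" by (simp add: r(2) power_mult_distrib)
    finally show ?thesis .
  qed
  then have "k \<le> m" unfolding m_def using y assms(1)
    by (intro dominant_index_greatest) (auto simp: k_def dominant_index_le_degree)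
  then show False using less by simp
qed

lemma sum_geometric_below: "(\<Sum>l<k. (1/8::real) ^ (k - l)) \<le> 1/7"
proof (induction k)
  case (Suc k)
  have "(\<Sum>l<Suc k. (1/8::real) ^ (Suc k - l)) = (\<Sum>l<k. 1/8 * (1/8) ^ (k - l)) + 1/8"
    by (simp add: Suc_diff_le)
  also have "(\<Sum>l<k. 1/8 * (1/8) ^ (k - l)) = 1/8 * (\<Sum>l<k. (1/8::real) ^ (k - l))"
    by (rule sum_distrib_left[symmetric])
  finally show ?case using Suc by linarith
qed simp

lemma sum_geometric_above: "(\<Sum>l\<in>{k<..d}. (1/8::real) ^ (l - k)) \<le> 1/7"
proof -
  have "(\<Sum>l\<in>{k<..k + e}. (1/8::real) ^ (l - k)) = (1 - (1/8) ^ e) / 7" for e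
  proof (induction e)
    case (Suc e)
    have "{k<..k + Suc e} = insert (k + Suc e) {k<..k + e}" by auto
    then have "(\<Sum>l\<in>{k<..k + Suc e}. (1/8::real) ^ (l - k)) =
        (1/8) ^ Suc e + (\<Sum>l\<in>{k<..k + e}. (1/8) ^ (l - k))" by simp
    moreover have "1/8 * X + (1 - X) / 7 = (1 - 1/8 * X) / 7" for X :: real by (simp add: field_simps)
    ultimately show ?case unfolding Suc power_Suc by simp
  qed simp
  from this[of "d - k"] show ?thesis by (cases "k \<le> d") (simp_all add: divide_right_mono)
qed

text \<open>If the same monomial dominates at two scales, then it dominates geometrically in between.\<close>

lemma dominant_monomial_approx:
  fixes p :: "real poly"
  assumes "a > 0" "8 * a \<le> x" "8 * x \<le> b" "dominant_index p a = k" "dominant_index p b = k" "\<bar>y\<bar> = x"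
  shows "\<bar>poly p y - coeff p k * y ^ k\<bar> \<le> 2/7 * (\<bar>coeff p k\<bar> * x ^ k)"
proof -
  define c where "c = \<bar>coeff p k\<bar> * x ^ k"
  have pos: "x > 0" "b > 0" using assms by auto
  have c0: "c \<ge> 0" using pos by (simp add: c_def)
  have below: "\<bar>coeff p l * y ^ l\<bar> \<le> c * (1/8) ^ (k - l)" if "l < k" for l
  proof -
    define r where "r = x / a"
    have r: "x = a * r" "r \<ge> 8" using assms by (auto simp: r_def field_simps)
    have "r ^ l * 8 ^ (k - l) \<le> r ^ l * r ^ (k - l)" using r by (intro mult_left_mono power_mono) auto
    also have "\<dots> = r ^ k" using that by (simp add: power_add[symmetric])
    finally have rl: "r ^ l \<le> r ^ k * (1/8) ^ (k - l)" by (simp add: power_divide field_simps)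
    have "\<bar>coeff p l * y ^ l\<bar> = (\<bar>coeff p l\<bar> * a ^ l) * r ^ l"
      by (simp add: abs_mult power_abs assms(6) r(1) power_mult_distrib)
    also have "\<dots> \<le> (\<bar>coeff p k\<bar> * a ^ k) * (r ^ k * (1/8) ^ (k - l))"
      using dominant_index_max[OF assms(1), of p l] assms(1,4) r(2) rl
      by (intro mult_mono[of "_ * _" _ "_ ^ _"]) auto
    also have "\<dots> = c * (1/8) ^ (k - l)" by (simp add: c_def r(1) power_mult_distrib)
    finally show ?thesis .
  qed
  have above: "\<bar>coeff p l * y ^ l\<bar> \<le> c * (1/8) ^ (l - k)" if "k < l" for l
  proof -
    define r where "r = x / b"
    have r: "x = b * r" "r \<le> 1/8" "r > 0" using assms pos by (auto simp: r_def field_simps)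
    have "r ^ l = r ^ k * r ^ (l - k)" using that by (simp add: power_add[symmetric])
    also have "\<dots> \<le> r ^ k * (1/8) ^ (l - k)" using r by (intro mult_left_mono power_mono) auto
    finally have rl: "r ^ l \<le> r ^ k * (1/8) ^ (l - k)" .
    have "\<bar>coeff p l * y ^ l\<bar> = (\<bar>coeff p l\<bar> * b ^ l) * r ^ l"
      by (simp add: abs_mult power_abs assms(6) r(1) power_mult_distrib)
    also have "\<dots> \<le> (\<bar>coeff p k\<bar> * b ^ k) * (r ^ k * (1/8) ^ (l - k))"
      using dominant_index_max[OF pos(2), of p l] pos assms(5) r rl
      by (intro mult_mono[of "_ * _" _ "_ ^ _"]) auto
    also have "\<dots> = c * (1/8) ^ (l - k)" by (simp add: c_def r(1) power_mult_distrib)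
    finally show ?thesis .
  qed
  have "k \<le> degree p" using dominant_index_le_degree[OF assms(1), of p] assms(4) by simp
  then have split: "{..degree p} = insert k ({..<k} \<union> {k<..degree p})" by auto
  have "poly p y = coeff p k * y ^ k + (\<Sum>l<k. coeff p l * y ^ l)
      + (\<Sum>l\<in>{k<..degree p}. coeff p l * y ^ l)"
    unfolding poly_altdef split by (subst sum.insert, simp, simp, subst sum.union_disjoint) auto
  then have "\<bar>poly p y - coeff p k * y ^ k\<bar> \<le>
      \<bar>\<Sum>l<k. coeff p l * y ^ l\<bar> + \<bar>\<Sum>l\<in>{k<..degree p}. coeff p l * y ^ l\<bar>" by linarith
  also have "\<dots> \<le> (\<Sum>l<k. c * (1/8) ^ (k - l)) + (\<Sum>l\<in>{k<..degree p}. c * (1/8) ^ (l - k))"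
    by (intro add_mono order_trans[OF sum_abs] sum_mono) (auto simp: below above)
  also have "\<dots> = c * ((\<Sum>l<k. (1/8) ^ (k - l)) + (\<Sum>l\<in>{k<..degree p}. (1/8) ^ (l - k)))"
    by (simp add: sum_distrib_left distrib_left)
  also have "\<dots> \<le> c * (1/7 + 1/7)"
    by (intro mult_left_mono add_mono sum_geometric_below sum_geometric_above c0)
  finally show ?thesis by (simp add: c_def)
qed

lemma coeff_pos_of_approx:
  fixes c :: real
  assumes "\<bar>v - c * x ^ k\<bar> \<le> 2/7 * (\<bar>c\<bar> * x ^ k)" "v > 0" "x > 0"
  shows "c > 0" "5/7 * (c * x ^ k) \<le> v" "v \<le> 9/7 * (c * x ^ k)"
proof -
  show "c > 0"
  proof (rule ccontr)
    assume "\<not> c > 0"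
    then have "\<bar>c\<bar> * x ^ k = - (c * x ^ k)" "c * x ^ k \<le> 0"
      using assms(3) by (auto simp: mult_nonpos_nonneg)
    then show False using assms(1,2) by linarith
  qed
  then have "\<bar>c\<bar> * x ^ k = c * x ^ k" by simp
  then show "5/7 * (c * x ^ k) \<le> v" "v \<le> 9/7 * (c * x ^ k)" using assms(1) by linarith+
qed

lemma monomial_gap:
  fixes c e x y \<delta> :: real
  assumes "l < k" "x > 0" "c > 0" "e > 0" "y = x * 2 ^ s" "\<delta> > 0"
    and "5/7 * (c * y ^ k) \<le> 2 * (9/7 * (e * y ^ l))" "\<delta> * (5/7 * (e * x ^ l)) \<le> 9/7 * (c * x ^ k)"
  shows "\<delta> * 2 ^ s \<le> 7"
proof -
  have y: "y > 0" using assms by simp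
  have "(5/7 * (c * y ^ k)) * (\<delta> * (5/7 * (e * x ^ l))) \<le> (2 * (9/7 * (e * y ^ l))) * (9/7 * (c * x ^ k))"
    by (rule mult_mono[OF assms(7,8)]) (use assms(2-4,6) y in simp_all)
  then have "(c * e) * (25 * \<delta> * (y ^ k * x ^ l)) \<le> (c * e) * (162 * (y ^ l * x ^ k))"
    by (simp add: field_simps)
  then have *: "25 * \<delta> * (y ^ k * x ^ l) \<le> 162 * (y ^ l * x ^ k)"
    using assms(3,4) by (simp add: mult_le_cancel_left_pos)
  have k: "k = l + (k - l)" using assms(1) by simp
  have "y ^ k * x ^ l = (y ^ l * x ^ k) * (2 ^ s) ^ (k - l)"
  proof -
    have "y ^ k = y ^ l * (x ^ (k - l) * (2 ^ s) ^ (k - l))"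
      by (subst k) (simp only: power_add assms(5) power_mult_distrib)
    moreover have "x ^ k = x ^ l * x ^ (k - l)" by (subst k) (simp only: power_add)
    ultimately show ?thesis by simp
  qed
  then have "(y ^ l * x ^ k) * (25 * \<delta> * (2 ^ s) ^ (k - l)) \<le> (y ^ l * x ^ k) * 162"
    using * by (simp only: mult_ac)
  then have "25 * \<delta> * (2 ^ s) ^ (k - l) \<le> 162"
    using y assms(2) by (simp add: mult_le_cancel_left_pos)
  moreover have "(2 ^ s) ^ 1 \<le> (2 ^ s :: real) ^ (k - l)"
    using assms(1) by (intro power_increasing) auto
  then have "25 * \<delta> * 2 ^ s \<le> 25 * \<delta> * (2 ^ s) ^ (k - l)"
    using assms(6) by (intro mult_left_mono) auto
  ultimately show ?thesis by linarith
qed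

lemma mono_pigeonhole:
  fixes g :: "nat \<Rightarrow> nat"
  assumes "mono g" "\<And>i. g i \<le> B"
  shows "\<exists>t\<le>B. g (t * w) = g (t * w + w)"
proof (rule ccontr)
  assume "\<not> ?thesis"
  then have ne: "g (t * w) \<noteq> g (t * w + w)" if "t \<le> B" for t using that by blast
  have "t \<le> g (t * w)" if "t \<le> Suc B" for t
    using that
  proof (induction t)
    case (Suc t)
    have "g (t * w) \<le> g (t * w + w)" using assms(1) by (intro monoD[OF assms(1)]) auto
    then show ?case using Suc ne[of t] by (simp add: add.commute)
  qed simp
  from this[of "Suc B"] show False using assms(2)[of "Suc B * w"] by simp
qed

lemma univariate_sign_gap:
  fixes P Q :: "real poly"
  assumes deg: "degree P \<le> D" "degree Q \<le> D" and "\<delta> > 0" and w: "w \<ge> 6" "(2 * D + 1) * w < n"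
    and pos: "\<And>k. k < n \<Longrightarrow> poly Q (2 ^ k) > 0" "\<And>k. k < n \<Longrightarrow> poly Q (- (2 ^ k)) > 0"
    and P1: "\<And>k. k < n \<Longrightarrow> \<delta> * poly Q (2 ^ k) \<le> poly P (2 ^ k)"
            "\<And>k. k < n \<Longrightarrow> poly P (2 ^ k) \<le> 2 * poly Q (2 ^ k)"
    and P2: "\<And>k. k < n \<Longrightarrow> poly P (- (2 ^ k)) < 0"
  shows "\<delta> * 2 ^ (w - 6) \<le> 7"
proof -
  define g where "g = (\<lambda>i::nat. dominant_index P (2 ^ i) + dominant_index Q (2 ^ i))"
  have mono: "dominant_index R (2 ^ i) \<le> dominant_index R (2 ^ j)" if "i \<le> j" for i j R
    using that by (intro dominant_index_mono power_increasing) auto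
  have "mono g" unfolding g_def by (intro monoI add_mono mono)
  moreover have "g i \<le> 2 * D" for i
    unfolding g_def using dominant_index_le_degree[of "2 ^ i" P] dominant_index_le_degree[of "2 ^ i" Q] deg
    by simp
  ultimately obtain t where t: "t \<le> 2 * D" "g (t * w) = g (t * w + w)"
    using mono_pigeonhole by blast
  define a :: real where "a = 2 ^ (t * w)"
  define b :: real where "b = 2 ^ (t * w + w)"
  define x :: real where "x = 2 ^ (t * w + 3)"
  define y :: real where "y = 2 ^ (t * w + w - 3)"
  define k where "k = dominant_index P a"
  define l where "l = dominant_index Q a"
  have kl: "dominant_index P b = k" "dominant_index Q b = l"
    using t(2) mono[of "t * w" "t * w + w" P] mono[of "t * w" "t * w + w" Q]
    unfolding g_def k_def l_def a_def b_def by auto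
  have "t * w + w \<le> (2 * D + 1) * w" using t(1) mult_le_mono1[of "t + 1" "2 * D + 1" w] by simp
  then have lt: "t * w + 3 < n" "t * w + w - 3 < n" using w by linarith+
  have a0: "a > 0" and x0: "x > 0" and y0: "y > 0" by (auto simp: a_def x_def y_def)
  have ax: "8 * a \<le> x" by (simp add: a_def x_def power_add)
  have "b = 2 ^ (t * w + w - 3 + 3)" using w by (simp add: b_def)
  then have yb: "8 * y \<le> b" unfolding power_add by (simp add: y_def)
  have "t * w + w - 3 = (t * w + 3) + (w - 6)" using w by simp
  then have yx: "y = x * 2 ^ (w - 6)" by (simp only: y_def x_def power_add)
  have "x * 1 \<le> x * 2 ^ (w - 6)" using x0 by (intro mult_left_mono) auto
  then have xy: "x \<le> y" using yx by simp
  note AP = dominant_monomial_approx[OF a0 _ _ k_def[symmetric] kl(1)]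
  note AQ = dominant_monomial_approx[OF a0 _ _ l_def[symmetric] kl(2)]
  have Q0: "poly Q x > 0" "poly Q y > 0" "poly Q (- x) > 0"
    unfolding x_def y_def using lt pos by auto
  have dP: "\<delta> * poly Q x \<le> poly P x" "\<delta> * poly Q y \<le> poly P y" "poly P x \<le> 2 * poly Q x"
    "poly P y \<le> 2 * poly Q y" "poly P (- x) < 0"
    unfolding x_def y_def using lt P1 P2 by auto
  have P0: "poly P x > 0" "poly P y > 0"
    using dP(1,2) Q0 \<open>\<delta> > 0\<close> by (auto intro: less_le_trans[OF mult_pos_pos])
  define c where "c = coeff P k"
  define e where "e = coeff Q l"
  have Px: "c > 0" "5/7 * (c * x ^ k) \<le> poly P x" "poly P x \<le> 9/7 * (c * x ^ k)"
    using coeff_pos_of_approx[OF AP[of x x] P0(1) x0] ax xy yb x0 by (auto simp: c_def)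
  have Py: "5/7 * (c * y ^ k) \<le> poly P y" "poly P y \<le> 9/7 * (c * y ^ k)"
    using coeff_pos_of_approx[OF AP[of y y] P0(2) y0] ax xy yb y0 by (auto simp: c_def)
  have Qx: "e > 0" "5/7 * (e * x ^ l) \<le> poly Q x" "poly Q x \<le> 9/7 * (e * x ^ l)"
    using coeff_pos_of_approx[OF AQ[of x x] Q0(1) x0] ax xy yb x0 by (auto simp: e_def)
  have Qy: "5/7 * (e * y ^ l) \<le> poly Q y" "poly Q y \<le> 9/7 * (e * y ^ l)"
    using coeff_pos_of_approx[OF AQ[of y y] Q0(2) y0] ax xy yb y0 by (auto simp: e_def)
  have "odd k"
  proof
    assume "even k"
    then have "\<bar>poly P (- x) - c * x ^ k\<bar> \<le> 2/7 * (c * x ^ k)"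
      using AP[of x "- x"] ax xy yb x0 Px(1) by (simp add: c_def)
    moreover have "c * x ^ k > 0" using Px(1) x0 by simp
    ultimately show False using dP(5) by linarith
  qed
  moreover have "even l"
  proof (rule ccontr)
    assume "odd l"
    then have "\<bar>poly Q (- x) + e * x ^ l\<bar> \<le> 2/7 * (e * x ^ l)"
      using AQ[of x "- x"] ax xy yb x0 Qx(1) by (simp add: e_def)
    moreover have "e * x ^ l > 0" using Qx(1) x0 by simp
    ultimately show False using Q0(3) by linarith
  qed
  ultimately have "k \<noteq> l" by auto
  have lower: "\<delta> * (5/7 * (e * z ^ l)) \<le> \<delta> * poly Q z" if "z = x \<or> z = y" for z
    using that Qx Qy \<open>\<delta> > 0\<close> by (intro mult_left_mono) auto
  show ?thesis
  proof (cases "l < k")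
    case True
    show ?thesis
      by (rule monomial_gap[OF True x0 Px(1) Qx(1) yx \<open>\<delta> > 0\<close>])
        (use Px Py Qx Qy dP lower[of x] in linarith)+
  next
    case False
    with \<open>k \<noteq> l\<close> have "k < l" by simp
    have l1: "\<delta> * (5/7 * (e * y ^ l)) \<le> 9/7 * (c * y ^ k)"
      using Py dP lower[of y] by linarith
    have l2: "5/7 * (c * x ^ k) \<le> 2 * (9/7 * (e * x ^ l))"
      using Px Qx dP by linarith
    have "5/7 * ((\<delta> * e) * y ^ l) \<le> 2 * (9/7 * ((c / 2) * y ^ k))" using l1 by (simp add: algebra_simps)
    moreover have "\<delta> * (5/7 * ((c / 2) * x ^ k)) \<le> 9/7 * ((\<delta> * e) * x ^ l)"
      using mult_left_mono[OF l2, of "\<delta> / 2"] \<open>\<delta> > 0\<close> by (simp add: algebra_simps)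
    ultimately show ?thesis
      using Px(1) Qx(1) \<open>\<delta> > 0\<close>
      by (intro monomial_gap[OF \<open>k < l\<close> x0 _ _ yx \<open>\<delta> > 0\<close>, of "\<delta> * e" "c / 2"]) auto
  qed
qed

section \<open>Reduction to one variable\<close>

inductive multilinear :: "'v set \<Rightarrow> nat \<Rightarrow> (('v \<Rightarrow> real) \<Rightarrow> real) \<Rightarrow> bool" for V d where
  basis: "S \<subseteq> V \<Longrightarrow> finite S \<Longrightarrow> card S \<le> d \<Longrightarrow> multilinear V d (\<lambda>x. \<Prod>v\<in>S. (1 + x v) / 2)"
| add: "multilinear V d f \<Longrightarrow> multilinear V d g \<Longrightarrow> multilinear V d (\<lambda>x. f x + g x)"
| scale: "multilinear V d f \<Longrightarrow> multilinear V d (\<lambda>x. c * f x)"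
| cong: "multilinear V d f \<Longrightarrow> (\<And>x. x \<in> sign_cube V \<Longrightarrow> f x = g x) \<Longrightarrow> multilinear V d g"

lemma multilinear_mono: "multilinear V d f \<Longrightarrow> d \<le> e \<Longrightarrow> multilinear V e f"
  by (induction rule: multilinear.induct) (auto intro: multilinear.intros)

lemma multilinear_const: "multilinear V d (\<lambda>x. c)"
  using multilinear.scale[OF multilinear.basis[of "{}" V d], of c] by simp

lemma multilinear_sum:
  "(\<And>i. i \<in> I \<Longrightarrow> multilinear V d (f i)) \<Longrightarrow> multilinear V d (\<lambda>x. \<Sum>i\<in>I. f i x)"
  by (induction I rule: infinite_finite_induct) (auto intro: multilinear.add multilinear_const)

lemma multilinear_var_mult:
  assumes "multilinear V d f" "v \<in> V" shows "multilinear V (Suc d) (\<lambda>x. x v * f x)"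
  using assms(1)
proof (induction rule: multilinear.induct)
  case (basis S)
  let ?b = "\<lambda>S x. \<Prod>v\<in>S. (1 + x v) / 2 :: real"
  have "multilinear V (Suc d) (\<lambda>x. 2 * ?b (insert v S) x + (- 1) * ?b S x)"
    using basis assms(2)
    by (intro multilinear.add multilinear.scale multilinear.basis) (auto simp: card_insert_if)
  moreover have "2 * ?b (insert v S) x + (- 1) * ?b S x = x v * ?b S x" if x: "x \<in> sign_cube V" for x
  proof (cases "v \<in> S")
    case True
    have "?b S x = (1 + x v) / 2 * ?b (S - {v}) x" using True basis by (intro prod.remove) auto
    then show ?thesis using True sign_cube_cases[OF x assms(2)] by (auto simp: insert_absorb)
  next
    case False then show ?thesis using basis by (simp add: field_simps)
  qed
  ultimately show ?case by (rule multilinear.cong)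
next
  case (add f g) then show ?case using multilinear.add by (fastforce simp: distrib_left)
next
  case (scale f c)
  from multilinear.scale[OF scale(2), of c] show ?case by (simp add: mult.left_commute)
next
  case (cong f g)
  from multilinear.cong[OF cong(3), of "\<lambda>x. x v * g x"] cong(2) show ?case by simp
qed

lemma multilinear_power_mult:
  assumes "multilinear V d f" "v \<in> V" shows "multilinear V (d + e) (\<lambda>x. x v ^ e * f x)"
proof (induction e)
  case (Suc e)
  from multilinear_var_mult[OF Suc assms(2)] show ?case by (simp add: mult.assoc)
qed (use assms in simp)

lemma multilinear_monom:
  assumes "finite K" "K \<subseteq> V" shows "multilinear V (\<Sum>v\<in>K. e v) (\<lambda>x. \<Prod>v\<in>K. x v ^ e v)"
  using assms
proof (induction K rule: finite_induct)
  case (insert v K)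
  then have "multilinear V (sum e K + e v) (\<lambda>x. x v ^ e v * (\<Prod>v\<in>K. x v ^ e v))"
    by (intro multilinear_power_mult) auto
  then show ?case using insert by (simp add: add.commute)
qed (simp add: multilinear_const)

lemma poly_fun_multilinear:
  assumes "f \<in> poly_fun V d" shows "multilinear V d f"
proof -
  obtain p where p: "f = poly_eval p" "poly_vars p \<subseteq> V" "total_deg p \<le> d"
    using assms unfolding poly_fun_def by blast
  have "multilinear V d (\<lambda>x. \<Sum>m\<in>Poly_Mapping.keys p. Poly_Mapping.lookup p m * monom_eval m x)"
  proof (intro multilinear_sum multilinear.scale)
    fix m assume m: "m \<in> Poly_Mapping.keys p"
    then have "multilinear V (mono_deg m) (monom_eval m)"
      unfolding mono_deg_def using p(2) by (intro multilinear_monom) (auto simp: poly_vars_def)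
    then show "multilinear V d (monom_eval m)"
      using m p(3) by (auto simp: total_deg_le_iff intro: multilinear_mono)
  qed
  then show ?thesis by (simp add: p(1) poly_eval_def[abs_def])
qed

lemma unique_binary_residue:
  fixes y :: int
  shows "\<exists>!I. I \<subseteq> {..<N} \<and> 2 ^ N dvd y - (\<Sum>i\<in>I. 2 ^ i)"
proof -
  define s where "s = (\<lambda>I::nat set. \<Sum>i\<in>I. 2 ^ i :: int)"
  have s: "s I = int (set_encode I)" if "I \<subseteq> {..<N}" for I
    unfolding s_def set_encode_def by simp
  have inj: "inj_on s (Pow {..<N})"
  proof (rule inj_onI)
    fix I J assume *: "I \<in> Pow {..<N}" "J \<in> Pow {..<N}" "s I = s J"
    then have "set_encode I = set_encode J" using s by simp
    moreover have "finite I" "finite J" using * by (auto intro: finite_subset)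
    ultimately show "I = J" by (simp add: set_encode_eq)
  qed
  have full: "s {..<N} = 2 ^ N - 1" unfolding s_def by (induction N) auto
  have sub: "s ` Pow {..<N} \<subseteq> {0..<2 ^ N}"
  proof clarify
    fix I assume "I \<subseteq> {..<N}"
    then have "s I \<le> s {..<N}" unfolding s_def by (intro sum_mono2) auto
    moreover have "s I \<ge> 0" unfolding s_def by (intro sum_nonneg) auto
    ultimately show "s I \<in> {0..<2 ^ N}" using full by simp
  qed
  have img: "s ` Pow {..<N} = {0..<2 ^ N}"
  proof (rule card_subset_eq[OF _ sub])
    show "card (s ` Pow {..<N}) = card {0..<2 ^ N :: int}"
      using card_image[OF inj] by (simp add: card_Pow nat_power_eq)
  qed simp
  have iff: "2 ^ N dvd y - s I \<longleftrightarrow> s I = y mod 2 ^ N" if "I \<subseteq> {..<N}" for I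
  proof -
    have "s I \<in> {0..<2 ^ N}" using sub that by blast
    then have "s I mod 2 ^ N = s I" by simp
    then show ?thesis by (metis mod_eq_dvd_iff)
  qed
  have "y mod 2 ^ N \<in> s ` Pow {..<N}" unfolding img by simp
  then obtain I where I: "I \<subseteq> {..<N}" "s I = y mod 2 ^ N" by auto
  have "\<exists>!I. I \<subseteq> {..<N} \<and> 2 ^ N dvd y - s I"
  proof (rule ex1I[of _ I])
    show "I \<subseteq> {..<N} \<and> 2 ^ N dvd y - s I" using I iff by simp
    fix J assume J: "J \<subseteq> {..<N} \<and> 2 ^ N dvd y - s J"
    then have "s J = s I" using I iff[of J] by simp
    then show "J = I" using inj_onD[OF inj] I J by simp
  qed
  then show ?thesis unfolding s_def .
qed

definition free_cells :: "nat \<Rightarrow> (nat \<times> nat) set" where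
  "free_cells n = {1..n-1} \<times> {3..n}"

definition cell_weight :: "nat \<times> nat \<Rightarrow> int" where
  "cell_weight v = 2 ^ (fst v - 1)"

definition weight :: "(nat \<times> nat) set \<Rightarrow> int" where
  "weight R = sum cell_weight R"

definition residue_sets :: "nat \<Rightarrow> int \<Rightarrow> (nat \<times> nat) set set" where
  "residue_sets n Y = {R. R \<subseteq> free_cells n \<and> 2 ^ (n - 1) dvd Y - weight R}"

lemma finite_free_cells [simp]: "finite (free_cells n)"
  by (simp add: free_cells_def)

lemma finite_residue_sets [simp]: "finite (residue_sets n Y)"
  unfolding residue_sets_def by simp

text \<open>Fewer than \<open>n - 2\<close> fixed cells leave a free cell in every row; these free cells can produce
  every residue in exactly one way. So the residue is independent of any \<open>n - 3\<close> cells.\<close>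

lemma card_residue_sets_containing:
  assumes S: "S \<subseteq> free_cells n" "card S < n - 2"
  obtains \<kappa> where "\<kappa> > 0" "\<And>Y. card {R \<in> residue_sets n Y. S \<subseteq> R} = \<kappa>"
proof -
  define N where "N = n - 1"
  have finS: "finite S" using S(1) by (rule finite_subset) simp
  have "\<exists>j\<in>{3..n}. (i, j) \<notin> S" for i
  proof (rule ccontr)
    assume "\<not> ?thesis"
    then have "{i} \<times> {3..n} \<subseteq> S" by auto
    then have "card ({i} \<times> {3..n}) \<le> card S" using finS by (rule card_mono[rotated])
    then show False using S(2) by (simp add: card_cartesian_product)
  qed
  then obtain j where j: "\<And>i. j i \<in> {3..n}" "\<And>i. (i, j i) \<notin> S" by metis
  define \<phi> where "\<phi> = (\<lambda>i. (Suc i, j (Suc i)))"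
  have inj: "inj \<phi>" by (auto simp: \<phi>_def inj_def)
  define G where "G = \<phi> ` {..<N}"
  have G: "G \<subseteq> free_cells n" "G \<inter> S = {}"
    using j by (auto simp: G_def \<phi>_def free_cells_def N_def)
  have uniq: "\<exists>!H. H \<subseteq> G \<and> 2 ^ N dvd y - weight H" for y
  proof -
    have w: "weight (\<phi> ` I) = (\<Sum>i\<in>I. 2 ^ i)" for I
      unfolding weight_def using inj
      by (subst sum.reindex) (auto simp: inj_on_def inj_def cell_weight_def \<phi>_def)
    define Pr where "Pr = (\<lambda>I. I \<subseteq> {..<N} \<and> 2 ^ N dvd y - (\<Sum>i\<in>I. 2 ^ i))"
    have "\<exists>!I. Pr I" unfolding Pr_def by (rule unique_binary_residue)
    then obtain I where I: "Pr I" and Iu: "\<And>J. Pr J \<Longrightarrow> J = I" by blast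
    show ?thesis
    proof (rule ex1I[of _ "\<phi> ` I"])
      show "\<phi> ` I \<subseteq> G \<and> 2 ^ N dvd y - weight (\<phi> ` I)"
        unfolding w G_def using I unfolding Pr_def by (elim conjE, intro conjI image_mono)
      fix H assume H: "H \<subseteq> G \<and> 2 ^ N dvd y - weight H"
      then have "H \<subseteq> \<phi> ` {..<N}" unfolding G_def by (rule conjunct1)
      then obtain J where J: "J \<subseteq> {..<N}" "H = \<phi> ` J" unfolding subset_image_iff by blast
      have "Pr J" unfolding Pr_def using J(1) conjunct2[OF H] unfolding J(2) w by (rule conjI)
      then show "H = \<phi> ` I" using J(2) Iu by simp
    qed
  qed
  have split: "weight R = weight (R - G) + weight (R \<inter> G)" if "R \<subseteq> free_cells n" for R
  proof -
    have "finite R" using that by (rule finite_subset) simp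
    then show ?thesis using sum.Int_Diff[of R cell_weight G] by (simp add: weight_def)
  qed
  define B where "B = {R'. R' \<subseteq> free_cells n - G \<and> S \<subseteq> R'}"
  have "finite B" unfolding B_def by simp
  moreover have "S \<in> B" using S G by (auto simp: B_def)
  ultimately have pos: "card B > 0" using card_gt_0_iff by blast
  have "card {R \<in> residue_sets n Y. S \<subseteq> R} = card B" for Y
  proof (rule bij_betw_same_card[of "\<lambda>R. R - G"], rule bij_betw_imageI)
    show "inj_on (\<lambda>R. R - G) {R \<in> residue_sets n Y. S \<subseteq> R}"
    proof (rule inj_onI)
      fix R1 R2 assume *: "R1 \<in> {R \<in> residue_sets n Y. S \<subseteq> R}" "R2 \<in> {R \<in> residue_sets n Y. S \<subseteq> R}"
        "R1 - G = R2 - G"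
      have "2 ^ N dvd (Y - weight (R1 - G)) - weight (R1 \<inter> G)"
        using * split[of R1] by (simp add: residue_sets_def N_def algebra_simps)
      moreover have "2 ^ N dvd (Y - weight (R1 - G)) - weight (R2 \<inter> G)"
        unfolding *(3) using * split[of R2] by (simp add: residue_sets_def N_def algebra_simps)
      ultimately have "R1 \<inter> G = R2 \<inter> G" using uniq[of "Y - weight (R1 - G)"] by blast
      then show "R1 = R2" using *(3) by blast
    qed
    show "(\<lambda>R. R - G) ` {R \<in> residue_sets n Y. S \<subseteq> R} = B"
    proof
      show "(\<lambda>R. R - G) ` {R \<in> residue_sets n Y. S \<subseteq> R} \<subseteq> B"
        using G by (auto simp: B_def residue_sets_def)
      show "B \<subseteq> (\<lambda>R. R - G) ` {R \<in> residue_sets n Y. S \<subseteq> R}"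
      proof
        fix R' assume R': "R' \<in> B"
        obtain H where H: "H \<subseteq> G" "2 ^ N dvd (Y - weight R') - weight H"
          using uniq[of "Y - weight R'"] by blast
        have sub: "R' \<union> H \<subseteq> free_cells n" using R' H G by (auto simp: B_def)
        have d: "(R' \<union> H) - G = R'" "(R' \<union> H) \<inter> G = H" using R' H by (auto simp: B_def)
        have "R' \<union> H \<in> {R \<in> residue_sets n Y. S \<subseteq> R}"
          using sub split[OF sub] H(2) R' unfolding d
          by (auto simp: residue_sets_def N_def B_def algebra_simps)
        then show "R' \<in> (\<lambda>R. R - G) ` {R \<in> residue_sets n Y. S \<subseteq> R}" using d(1) by blast
      qed
    qed
  qed
  with pos show ?thesis by (rule that)
qed

lemma residue_sets_moment:
  assumes "S \<subseteq> free_cells n" "card S + e < n - 2"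
  shows "\<exists>\<kappa>::real. \<forall>Y. (\<Sum>R\<in>residue_sets n Y. of_bool (S \<subseteq> R) * real_of_int (weight R) ^ e) = \<kappa>"
  using assms
proof (induction e arbitrary: S)
  case 0
  then obtain \<kappa> where "\<And>Y. card {R \<in> residue_sets n Y. S \<subseteq> R} = \<kappa>"
    using card_residue_sets_containing[of S n] by (metis add.right_neutral)
  then have "(\<Sum>R\<in>residue_sets n Y. of_bool (S \<subseteq> R) :: real) = real \<kappa>" for Y
    by (simp add: Int_def)
  then show ?case by auto
next
  case (Suc e)
  have finS: "finite S" using Suc.prems(1) by (rule finite_subset) simp
  have "\<exists>\<kappa>::real. \<forall>Y. (\<Sum>R\<in>residue_sets n Y. of_bool (insert v S \<subseteq> R) * real_of_int (weight R) ^ e) = \<kappa>"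
    if "v \<in> free_cells n" for v
    using that Suc.prems finS by (intro Suc.IH) (auto simp: card_insert_if)
  then obtain \<kappa> :: "_ \<Rightarrow> real" where \<kappa>: "\<And>v Y. v \<in> free_cells n \<Longrightarrow>
      (\<Sum>R\<in>residue_sets n Y. of_bool (insert v S \<subseteq> R) * real_of_int (weight R) ^ e) = \<kappa> v"
    by metis
  have w: "real_of_int (weight R) = (\<Sum>v\<in>free_cells n. of_bool (v \<in> R) * real_of_int (cell_weight v))"
    if "R \<subseteq> free_cells n" for R
  proof -
    have "(\<Sum>v\<in>free_cells n. of_bool (v \<in> R) * real_of_int (cell_weight v)) =
        (\<Sum>v\<in>R. of_bool (v \<in> R) * real_of_int (cell_weight v))"
      by (rule sum.mono_neutral_right) (use that in auto)
    then show ?thesis by (simp add: weight_def)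
  qed
  have "(\<Sum>R\<in>residue_sets n Y. of_bool (S \<subseteq> R) * real_of_int (weight R) ^ Suc e) =
      (\<Sum>v\<in>free_cells n. real_of_int (cell_weight v) * \<kappa> v)" for Y
  proof -
    have "(\<Sum>R\<in>residue_sets n Y. of_bool (S \<subseteq> R) * real_of_int (weight R) ^ Suc e) =
      (\<Sum>R\<in>residue_sets n Y. \<Sum>v\<in>free_cells n. real_of_int (cell_weight v) *
         (of_bool (insert v S \<subseteq> R) * real_of_int (weight R) ^ e))"
    proof (rule sum.cong[OF refl])
      fix R assume "R \<in> residue_sets n Y"
      then have "R \<subseteq> free_cells n" by (simp add: residue_sets_def)
      have "of_bool (S \<subseteq> R) * real_of_int (weight R) ^ Suc e =
          (of_bool (S \<subseteq> R) * real_of_int (weight R) ^ e) * real_of_int (weight R)" by simp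
      also have "\<dots> = (\<Sum>v\<in>free_cells n. (of_bool (S \<subseteq> R) * real_of_int (weight R) ^ e) *
          (of_bool (v \<in> R) * real_of_int (cell_weight v)))"
        unfolding w[OF \<open>R \<subseteq> free_cells n\<close>] by (rule sum_distrib_left)
      also have "\<dots> = (\<Sum>v\<in>free_cells n. real_of_int (cell_weight v) *
         (of_bool (insert v S \<subseteq> R) * real_of_int (weight R) ^ e))"
        by (rule sum.cong) auto
      finally show "of_bool (S \<subseteq> R) * real_of_int (weight R) ^ Suc e = \<dots>" .
    qed
    also have "\<dots> = (\<Sum>v\<in>free_cells n. real_of_int (cell_weight v) *
         (\<Sum>R\<in>residue_sets n Y. of_bool (insert v S \<subseteq> R) * real_of_int (weight R) ^ e))"
      by (subst sum.swap) (simp only: sum_distrib_left)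
    also have "\<dots> = (\<Sum>v\<in>free_cells n. real_of_int (cell_weight v) * \<kappa> v)"
      by (intro sum.cong refl) (simp only: \<kappa>)
    finally show ?thesis .
  qed
  then show ?case by blast
qed

lemma residue_sets_polynomial:
  assumes S: "S \<subseteq> free_cells n" "card S + e < n - 2" and H: "degree H \<le> e"
  shows "\<exists>P :: real poly. degree P \<le> e \<and> (\<forall>Y. (\<Sum>R\<in>residue_sets n Y.
    of_bool (S \<subseteq> R) * poly H (real_of_int (Y - weight R))) = poly P (real_of_int Y))"
proof -
  have "\<exists>\<kappa>::real. \<forall>Y. (\<Sum>R\<in>residue_sets n Y. of_bool (S \<subseteq> R) * real_of_int (weight R) ^ k) = \<kappa>"
    if "k \<le> e" for k
    using S that by (intro residue_sets_moment) auto
  then obtain \<kappa> :: "nat \<Rightarrow> real" where \<kappa>: "\<And>k Y. k \<le> e \<Longrightarrow>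
      (\<Sum>R\<in>residue_sets n Y. of_bool (S \<subseteq> R) * real_of_int (weight R) ^ k) = \<kappa> k" by metis
  define P where "P = (\<Sum>k\<le>e. \<Sum>a\<le>k. monom (coeff H k * real (k choose a) * (-1) ^ (k - a) * \<kappa> (k - a)) a)"
  have "degree P \<le> e"
    unfolding P_def by (intro degree_sum_le) (auto intro: order_trans[OF degree_monom_le])
  moreover have "(\<Sum>R\<in>residue_sets n Y. of_bool (S \<subseteq> R) * poly H (real_of_int (Y - weight R)))
      = poly P (real_of_int Y)" for Y
  proof -
    have pH: "poly H x = (\<Sum>k\<le>e. coeff H k * x ^ k)" for x
      unfolding poly_altdef using H by (intro sum.mono_neutral_left) (auto simp: coeff_eq_0)
    have "(\<Sum>R\<in>residue_sets n Y. of_bool (S \<subseteq> R) * poly H (real_of_int (Y - weight R))) =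
      (\<Sum>R\<in>residue_sets n Y. \<Sum>k\<le>e. \<Sum>a\<le>k.
         (coeff H k * real (k choose a) * (-1) ^ (k - a) * real_of_int Y ^ a) *
         (of_bool (S \<subseteq> R) * real_of_int (weight R) ^ (k - a)))"
    proof (intro sum.cong refl)
      fix R
      have "real_of_int (Y - weight R) ^ k = (\<Sum>a\<le>k. real (k choose a) * real_of_int Y ^ a *
          ((-1) ^ (k - a) * real_of_int (weight R) ^ (k - a)))" for k
        using binomial_ring[of "real_of_int Y" "- real_of_int (weight R)" k]
        by (simp add: power_minus[of "real_of_int (weight R)"])
      then show "of_bool (S \<subseteq> R) * poly H (real_of_int (Y - weight R)) =
        (\<Sum>k\<le>e. \<Sum>a\<le>k. (coeff H k * real (k choose a) * (-1) ^ (k - a) * real_of_int Y ^ a) *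
         (of_bool (S \<subseteq> R) * real_of_int (weight R) ^ (k - a)))"
        unfolding pH by (simp only: sum_distrib_left mult_ac)
    qed
    also have "\<dots> = (\<Sum>k\<le>e. \<Sum>a\<le>k. \<Sum>R\<in>residue_sets n Y.
         (coeff H k * real (k choose a) * (-1) ^ (k - a) * real_of_int Y ^ a) *
         (of_bool (S \<subseteq> R) * real_of_int (weight R) ^ (k - a)))"
      by (subst sum.swap, intro sum.cong refl, subst sum.swap, rule refl)
    also have "\<dots> = (\<Sum>k\<le>e. \<Sum>a\<le>k.
         (coeff H k * real (k choose a) * (-1) ^ (k - a) * real_of_int Y ^ a) * \<kappa> (k - a))"
      unfolding sum_distrib_left[symmetric] by (intro sum.cong refl arg_cong2[of _ _ _ _ "(*)"] \<kappa>) auto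
    also have "\<dots> = poly P (real_of_int Y)"
      unfolding P_def by (simp add: poly_sum poly_monom mult_ac)
    finally show ?thesis .
  qed
  ultimately show ?thesis by blast
qed

lemma card_subsets_containing:
  assumes B: "finite B" "card B = n" and T: "T \<subseteq> B" "card T = e" and "c \<le> n"
  shows "real (card {C. C \<subseteq> B \<and> card C = c \<and> T \<subseteq> C}) =
    real (n choose c) * (\<Prod>i<e. (real c - real i) / (real n - real i))"
proof -
  have en: "e \<le> n" using B T card_mono by blast
  have finT: "finite T" using T B finite_subset by blast
  show ?thesis
  proof (cases "c < e")
    case True
    have "\<not> (C \<subseteq> B \<and> card C = c \<and> T \<subseteq> C)" for C
      using card_mono[of C T] True T B by (meson finite_subset leD)
    then have "{C. C \<subseteq> B \<and> card C = c \<and> T \<subseteq> C} = {}" by blast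
    moreover have "(\<Prod>i<e. (real c - real i) / (real n - real i)) = 0"
      using True by (intro prod_zero) auto
    ultimately show ?thesis by (simp only: card.empty)
  next
    case False
    then have ec: "e \<le> c" by simp
    have "card {C. C \<subseteq> B \<and> card C = c \<and> T \<subseteq> C} = card {D. D \<subseteq> B - T \<and> card D = c - e}"
    proof (rule bij_betw_same_card[of "\<lambda>C. C - T"], rule bij_betwI[where g = "\<lambda>D. D \<union> T"])
      show "(\<lambda>C. C - T) \<in> {C. C \<subseteq> B \<and> card C = c \<and> T \<subseteq> C} \<rightarrow> {D. D \<subseteq> B - T \<and> card D = c - e}"
        using T finT by (auto simp: card_Diff_subset)
      show "(\<lambda>D. D \<union> T) \<in> {D. D \<subseteq> B - T \<and> card D = c - e} \<rightarrow> {C. C \<subseteq> B \<and> card C = c \<and> T \<subseteq> C}"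
      proof clarsimp
        fix D assume D: "D \<subseteq> B - T" "card D = c - e"
        have "finite D" using D(1) B(1) finite_subset by blast
        then have "card (D \<union> T) = c" using D T(2) finT ec by (subst card_Un_disjoint) auto
        then show "D \<subseteq> B \<and> T \<subseteq> B \<and> card (D \<union> T) = c" using D T by auto
      qed
    qed auto
    also have "\<dots> = (n - e choose (c - e))"
      using B T finT by (subst n_subsets) (auto simp: card_Diff_subset)
    also have "real \<dots> = real (n choose c) * (\<Prod>i<e. (real c - real i) / (real n - real i))"
      using ec
    proof (induction e)
      case (Suc e)
      have "n - e = Suc (n - Suc e)" "c - e = Suc (c - Suc e)" using Suc.prems \<open>c \<le> n\<close> by auto
      then have "(c - e) * (n - e choose (c - e)) = (n - e) * (n - Suc e choose (c - Suc e))"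
        using Suc_times_binomial_eq[of "n - Suc e" "c - Suc e"] by (simp only: mult.commute)
      then have "real (c - e) * real (n - e choose (c - e)) = real (n - e) * real (n - Suc e choose (c - Suc e))"
        unfolding of_nat_mult[symmetric] by (rule arg_cong)
      then have "(real c - real e) * real (n - e choose (c - e)) =
          (real n - real e) * real (n - Suc e choose (c - Suc e))"
        using Suc.prems \<open>c \<le> n\<close> by (simp add: of_nat_diff)
      moreover have "real n - real e > 0" using Suc.prems \<open>c \<le> n\<close> by simp
      ultimately have "real (n - Suc e choose (c - Suc e)) =
          real (n - e choose (c - e)) * ((real c - real e) / (real n - real e))"
        by (simp add: field_simps)
      then show ?case using Suc by simp
    qed simp
    finally show ?thesis .
  qed
qed

text \<open>In the lower bound, the first cell of each row but the last is fixed to \<open>1\<close> and the second one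
  to \<open>-1\<close>, which leaves room for the last row to absorb the carry. A set \<open>R\<close> of free cells and a set \<open>C\<close>
  of columns of the last row together form a configuration if \<open>weight R + 2 ^ (n - 1) * card C\<close> equals
  \<open>target n z\<close>; the linear form of the halfspace then evaluates to \<open>4 z + 1\<close> or \<open>4 z + 3\<close>,
  depending on the parity of \<open>n\<close>.\<close>

definition target :: "nat \<Rightarrow> int \<Rightarrow> int" where
  "target n z = (int n - 1) * 2 ^ (n - 1) + 1 - int (n div 2) + z"

definition cells :: "nat \<Rightarrow> (nat \<times> nat) set \<Rightarrow> nat set \<Rightarrow> (nat \<times> nat) set" where
  "cells n R C = {1..n-1} \<times> {1} \<union> R \<union> {n} \<times> C"

definition sign_point :: "'v set \<Rightarrow> 'v set \<Rightarrow> 'v \<Rightarrow> real" where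
  "sign_point V A = (\<lambda>v\<in>V. if v \<in> A then 1 else - 1)"

definition configs :: "nat \<Rightarrow> int \<Rightarrow> ((nat \<times> nat) set \<times> nat set) set" where
  "configs n z = Sigma (residue_sets n (target n z))
     (\<lambda>R. {C. C \<subseteq> {1..n} \<and> 2 ^ (n - 1) * int (card C) = target n z - weight R})"

definition average :: "nat \<Rightarrow> int \<Rightarrow> ((nat \<times> nat \<Rightarrow> real) \<Rightarrow> real) \<Rightarrow> real" where
  "average n z g =
     (\<Sum>(R, C)\<in>configs n z. g (sign_point (grid n) (cells n R C)) / real (n choose card C))"

lemma sign_point_in_cube [simp]: "sign_point V A \<in> sign_cube V"
  unfolding sign_point_def sign_cube_def by auto

lemma average_add: "average n z (\<lambda>x. f x + g x) = average n z f + average n z g"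
  unfolding average_def by (simp add: case_prod_unfold add_divide_distrib sum.distrib)

lemma average_scale: "average n z (\<lambda>x. c * f x) = c * average n z f"
  unfolding average_def by (simp add: case_prod_unfold sum_distrib_left)

lemma average_cong:
  "(\<And>x. x \<in> sign_cube (grid n) \<Longrightarrow> f x = g x) \<Longrightarrow> average n z f = average n z g"
  unfolding average_def by simp

lemma finite_configs [simp]: "finite (configs n z)"
  unfolding configs_def by (intro finite_SigmaI) auto

lemma sum_powers_of_two: "(\<Sum>i=1..n. 2 ^ (i - 1)) = (2 ^ n - 1 :: int)"
  by (induction n) auto

lemma weight_times: "finite J \<Longrightarrow> weight ({1..n} \<times> J) = int (card J) * (2 ^ n - 1)"
  unfolding weight_def sum_powers_of_two[symmetric]
  using sum.cartesian_product[of "\<lambda>i j. 2 ^ (i - 1) :: int" J "{1..n}"]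
  by (simp add: cell_weight_def sum_distrib_left case_prod_unfold)

lemma config_count:
  assumes "n \<ge> 3" "\<bar>z\<bar> \<le> 2 ^ (n - 1)" "R \<in> residue_sets n (target n z)"
  obtains c where "c \<le> n" "2 ^ (n - 1) * int c = target n z - weight R"
proof -
  define N :: int where "N = 2 ^ (n - 1)"
  have R: "R \<subseteq> free_cells n" "N dvd target n z - weight R"
    using assms(3) by (auto simp: residue_sets_def N_def)
  then obtain q where q: "target n z - weight R = N * q" by (auto simp: dvd_def)
  have N: "N > 0" by (simp add: N_def)
  have "weight R \<ge> 0" unfolding weight_def by (rule sum_nonneg) (simp add: cell_weight_def)
  have "weight R \<le> weight (free_cells n)"
    unfolding weight_def using R by (intro sum_mono2) (auto simp: cell_weight_def)
  also have "\<dots> = (int n - 2) * (N - 1)"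
    unfolding free_cells_def N_def using assms(1) by (subst weight_times) auto
  finally have wR: "weight R \<le> (int n - 2) * (N - 1)" .
  have t: "target n z = (int n - 1) * N + 1 - int (n div 2) + z" unfolding target_def N_def ..
  have z: "- N \<le> z" "z \<le> N" using assms(2) unfolding N_def by linarith+
  have h: "int (n div 2) \<ge> 1" "int (n div 2) \<le> int n - 1" using assms(1) by linarith+
  have "N * q \<ge> 0" using q wR t z h by (simp add: algebra_simps)
  then have q0: "q \<ge> 0" using N by (simp add: zero_le_mult_iff)
  have "N * q \<le> N * int n" using q \<open>weight R \<ge> 0\<close> t z h by (simp add: algebra_simps)
  then have "q \<le> int n" using N by simp
  then show ?thesis using q q0 that[of "nat q"] by (simp add: N_def)
qed

lemma configs_nonempty:
  assumes "n \<ge> 3" "\<bar>z\<bar> \<le> 2 ^ (n - 1)" shows "configs n z \<noteq> {}"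
proof -
  obtain \<kappa> where \<kappa>: "\<kappa> > 0" "\<And>Y. card {R \<in> residue_sets n Y. {} \<subseteq> R} = \<kappa>"
    using card_residue_sets_containing[of "{}" n] assms(1) by (metis card.empty empty_subsetI
        numeral_3_eq_3 numeral_2_eq_2 zero_less_diff less_le_trans lessI)
  then have "{R \<in> residue_sets n (target n z). {} \<subseteq> R} \<noteq> {}" by (metis card.empty less_irrefl)
  then obtain R where R: "R \<in> residue_sets n (target n z)" by blast
  obtain c where c: "c \<le> n" "2 ^ (n - 1) * int c = target n z - weight R"
    using config_count[OF assms R] .
  then have "(R, {1..c}) \<in> configs n z" using R by (auto simp: configs_def)
  then show ?thesis by blast
qed

lemma halfspace_config:
  assumes "n \<ge> 1" "(R, C) \<in> configs n z"
  shows "halfspace n (sign_point (grid n) (cells n R C)) = (if z \<ge> 0 then 1 else - 1)"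
proof -
  define A where "A = cells n R C"
  define N :: int where "N = 2 ^ (n - 1)"
  have R: "R \<subseteq> free_cells n" and C: "C \<subseteq> {1..n}" "N * int (card C) = target n z - weight R"
    using assms(2) by (auto simp: configs_def residue_sets_def N_def)
  have fin: "finite R" "finite C" using R C by (auto intro: finite_subset)
  have "R \<subseteq> grid n" using R by (rule order_trans) (auto simp: free_cells_def grid_def)
  then have sub: "A \<subseteq> grid n" using C assms(1) unfolding A_def cells_def by (auto simp: grid_def)
  have "weight A = weight ({1..n-1} \<times> {1}) + weight R + weight ({n} \<times> C)"
  proof -
    have "({1..n-1} \<times> {1}) \<inter> free_cells n = {}" "({n} \<times> C) \<inter> free_cells n = {}"
      "({1..n-1} \<times> {1}) \<inter> ({n} \<times> C) = {}"
      using assms(1) by (auto simp: free_cells_def)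
    then have "({1..n-1} \<times> {1}) \<inter> R = {}" "({1..n-1} \<times> {1} \<union> R) \<inter> ({n} \<times> C) = {}"
      using R by blast+
    then show ?thesis
      unfolding A_def cells_def weight_def using fin by (simp add: sum.union_disjoint)
  qed
  moreover have "weight ({1..n-1} \<times> {1}) = N - 1" by (subst weight_times) (auto simp: N_def)
  moreover have "weight ({n} \<times> C) = N * int (card C)"
  proof -
    have "weight ({n} \<times> C) = (\<Sum>v\<in>{n} \<times> C. N)"
      unfolding weight_def by (rule sum.cong) (auto simp: cell_weight_def N_def)
    then show ?thesis by (simp add: card_cartesian_product)
  qed
  moreover have "target n z = (int n - 1) * N + 1 - int (n div 2) + z" unfolding target_def N_def ..
  ultimately have wA: "weight A = int n * N - int (n div 2) + z"
    using C(2) by (simp add: algebra_simps)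
  have "weight (grid n) = int n * (2 ^ n - 1)" unfolding grid_def by (subst weight_times) auto
  also have "(2 ^ n :: int) = 2 * N" unfolding N_def using assms(1) by (simp flip: power_Suc)
  finally have wg: "weight (grid n) = int n * (2 * N - 1)" .
  have "(\<Sum>i=1..n. \<Sum>j=1..n. 2 ^ i * sign_point (grid n) A (i, j)) =
      (\<Sum>v\<in>grid n. 2 ^ fst v * sign_point (grid n) A v)"
    unfolding grid_def by (simp add: sum.cartesian_product case_prod_unfold)
  also have "\<dots> = (\<Sum>v\<in>grid n. 4 * (if v \<in> A then real_of_int (cell_weight v) else 0)
      - 2 * real_of_int (cell_weight v))"
  proof (rule sum.cong[OF refl])
    fix v assume v: "v \<in> grid n"
    then have "fst v = Suc (fst v - 1)" by (auto simp: grid_def)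
    then have "(2::real) ^ fst v = 2 * real_of_int (cell_weight v)"
      unfolding cell_weight_def by (metis of_int_numeral of_int_power power_Suc)
    then show "2 ^ fst v * sign_point (grid n) A v =
        4 * (if v \<in> A then real_of_int (cell_weight v) else 0) - 2 * real_of_int (cell_weight v)"
      using v by (simp add: sign_point_def)
  qed
  also have "\<dots> = 4 * (\<Sum>v\<in>grid n. if v \<in> A then real_of_int (cell_weight v) else 0)
      - 2 * (\<Sum>v\<in>grid n. real_of_int (cell_weight v))"
    by (simp add: sum_subtractf sum_distrib_left)
  also have "(\<Sum>v\<in>grid n. if v \<in> A then real_of_int (cell_weight v) else 0) = real_of_int (weight A)"
    unfolding weight_def using sub by (simp add: sum.If_cases Int_absorb1)
  also have "(\<Sum>v\<in>grid n. real_of_int (cell_weight v)) = real_of_int (weight (grid n))"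
    unfolding weight_def by simp
  also have "4 * real_of_int (weight A) - 2 * real_of_int (weight (grid n)) =
      real_of_int (4 * weight A - 2 * weight (grid n))" by simp
  also have "4 * weight A - 2 * weight (grid n) = 4 * z + 2 * int n - 4 * int (n div 2)"
    unfolding wA wg by (simp add: algebra_simps)
  finally have "halfspace n (sign_point (grid n) A) =
      sgn (real_of_int (1 + (4 * z + 2 * int n - 4 * int (n div 2))))"
    unfolding halfspace_def by simp
  also have "\<dots> = (if z \<ge> 0 then 1 else - 1)"
  proof (cases "z \<ge> 0")
    case True
    then have "1 + (4 * z + 2 * int n - 4 * int (n div 2)) > 0" by linarith
    then show ?thesis using True by (simp add: sgn_1_pos del: of_int_add of_int_diff)
  next
    case False
    then have "1 + (4 * z + 2 * int n - 4 * int (n div 2)) < 0" by linarith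
    then show ?thesis using False by (simp add: sgn_1_neg del: of_int_add of_int_diff)
  qed
  finally show ?thesis unfolding A_def .
qed

lemma average_basis_polynomial:
  assumes "n \<ge> 3" "S \<subseteq> grid n" "card S \<le> d" "d < n - 2"
  shows "\<exists>P :: real poly. degree P \<le> d \<and> (\<forall>z. \<bar>z\<bar> \<le> 2 ^ (n - 1) \<longrightarrow>
    average n z (\<lambda>x. \<Prod>v\<in>S. (1 + x v) / 2) = poly P (real_of_int z))"
proof -
  define S1 where "S1 = S \<inter> free_cells n"
  define T where "T = {j. (n, j) \<in> S}"
  define e where "e = card T"
  define good where "good \<longleftrightarrow> (\<forall>v\<in>S. fst v < n \<longrightarrow> snd v \<noteq> 2)"
  have finS: "finite S" using assms(2) by (rule finite_subset) simp
  have T: "T \<subseteq> {1..n}" using assms(2) by (auto simp: T_def grid_def)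
  have "card S1 + e = card (S1 \<union> {n} \<times> T)"
    unfolding e_def using finS T
    by (subst card_Un_disjoint) (auto simp: S1_def free_cells_def card_cartesian_product
        intro: finite_subset)
  also have "\<dots> \<le> card S" using finS by (intro card_mono) (auto simp: S1_def T_def)
  finally have Se: "card S1 + e \<le> d" using assms(3) by simp
  define ff :: "real poly" where "ff = (\<Prod>i<e. smult (1 / (real n - real i)) [:- real i, 1:])"
  have ff: "poly ff c = (\<Prod>i<e. (c - real i) / (real n - real i))" for c
    unfolding ff_def by (simp add: poly_prod diff_divide_distrib)
  have "degree ff \<le> sum (degree \<circ> (\<lambda>i. smult (1 / (real n - real i)) [:- real i, 1:])) {..<e}"
    unfolding ff_def by (rule degree_prod_sum_le) simp
  also have "\<dots> \<le> (\<Sum>i<e. 1)" by (intro sum_mono) simp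
  finally have dff: "degree ff \<le> e" by simp
  define H where "H = pcompose ff [:0, 1 / 2 ^ (n - 1):]"
  have H: "poly H y = poly ff (y / 2 ^ (n - 1))" for y unfolding H_def by (simp add: poly_pcompose)
  have dH: "degree H \<le> e" unfolding H_def using dff by (simp add: degree_pcompose)
  obtain P where P: "degree P \<le> e" "\<And>Y. (\<Sum>R\<in>residue_sets n Y.
    of_bool (S1 \<subseteq> R) * poly H (real_of_int (Y - weight R))) = poly P (real_of_int Y)"
    using residue_sets_polynomial[of S1 n e H] Se assms(4) dH by (auto simp: S1_def)
  define P' where "P' = smult (of_bool good) (pcompose P [:real_of_int (target n 0), 1:])"
  have "degree P' \<le> d"
    unfolding P'_def using P(1) Se by (intro order_trans[OF degree_smult_le]) (simp add: degree_pcompose)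
  moreover have "average n z (\<lambda>x. \<Prod>v\<in>S. (1 + x v) / 2) = poly P' (real_of_int z)"
    if z: "\<bar>z\<bar> \<le> 2 ^ (n - 1)" for z
  proof -
    define Y where "Y = target n z"
    let ?Cs = "\<lambda>R. {C. C \<subseteq> {1..n} \<and> 2 ^ (n - 1) * int (card C) = Y - weight R}"
    have b: "(\<Prod>v\<in>S. (1 + sign_point (grid n) A v) / 2) = of_bool (S \<subseteq> A)" for A
    proof -
      have "(\<Prod>v\<in>S. (1 + sign_point (grid n) A v) / 2) = (\<Prod>v\<in>S. of_bool (v \<in> A))"
        using assms(2) by (intro prod.cong) (auto simp: sign_point_def)
      also have "\<dots> = of_bool (S \<subseteq> A)" using finS by (induction S rule: finite_induct) auto
      finally show ?thesis .
    qed
    have sub: "of_bool (S \<subseteq> cells n R C) = (of_bool good * (of_bool (S1 \<subseteq> R) * of_bool (T \<subseteq> C)) :: real)"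
      if "R \<subseteq> free_cells n" for R C
    proof -
      have "S \<subseteq> cells n R C \<longleftrightarrow> good \<and> S1 \<subseteq> R \<and> T \<subseteq> C"
      proof
        assume L: "S \<subseteq> cells n R C"
        show "good \<and> S1 \<subseteq> R \<and> T \<subseteq> C"
        proof (intro conjI)
          show good unfolding good_def
          proof (intro ballI impI)
            fix v assume "v \<in> S" "fst v < n"
            then have "v \<in> {1..n-1} \<times> {1} \<union> R" using L by (auto simp: cells_def)
            then show "snd v \<noteq> 2" using that by (auto simp: free_cells_def)
          qed
          show "S1 \<subseteq> R" using L assms(1) by (auto simp: S1_def cells_def free_cells_def)
          have "({n} \<times> UNIV) \<inter> free_cells n = {}" using assms(1) by (auto simp: free_cells_def)
          then have "(n, j) \<notin> R" for j using that by blast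
          then show "T \<subseteq> C" using L assms(1) by (auto simp: T_def cells_def)
        qed
      next
        assume Rr: "good \<and> S1 \<subseteq> R \<and> T \<subseteq> C"
        show "S \<subseteq> cells n R C"
        proof
          fix v assume v: "v \<in> S"
          obtain i j where ij: "v = (i, j)" by (cases v)
          have g: "i \<in> {1..n}" "j \<in> {1..n}" using v assms(2) ij by (auto simp: grid_def)
          consider "i = n" | "i < n" "j = 1" | "i < n" "j = 2" | "i < n" "j \<ge> 3" using g by fastforce
          then show "v \<in> cells n R C"
          proof cases
            case 1 then have "j \<in> C" using v Rr ij by (auto simp: T_def)
            then show ?thesis using 1 ij by (simp add: cells_def)
          next
            case 2 then show ?thesis using g ij by (auto simp: cells_def)
          next
            case 3 then show ?thesis using Rr v ij by (auto simp: good_def)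
          next
            case 4 then have "v \<in> S1" using v g ij by (auto simp: S1_def free_cells_def)
            then show ?thesis using Rr by (auto simp: cells_def)
          qed
        qed
      qed
      then show ?thesis by simp
    qed
    have inner: "(\<Sum>C\<in>?Cs R. of_bool (T \<subseteq> C) / real (n choose card C)) = poly H (real_of_int (Y - weight R))"
      if R: "R \<in> residue_sets n Y" for R
    proof -
      obtain c where c: "c \<le> n" "2 ^ (n - 1) * int c = Y - weight R"
        using config_count[OF assms(1) z] R unfolding Y_def by blast
      have Cs: "?Cs R = {C. C \<subseteq> {1..n} \<and> card C = c}" unfolding c(2)[symmetric] by auto
      have "(\<Sum>C\<in>?Cs R. of_bool (T \<subseteq> C) / real (n choose card C)) =
          (\<Sum>C\<in>{C. C \<subseteq> {1..n} \<and> card C = c}. of_bool (T \<subseteq> C)) / real (n choose c)"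
        unfolding Cs sum_divide_distrib by (rule sum.cong) auto
      also have "(\<Sum>C\<in>{C. C \<subseteq> {1..n} \<and> card C = c}. of_bool (T \<subseteq> C)) =
          real (card ({C. C \<subseteq> {1..n} \<and> card C = c} \<inter> {C. T \<subseteq> C}))" by simp
      also have "{C. C \<subseteq> {1..n} \<and> card C = c} \<inter> {C. T \<subseteq> C} = {C. C \<subseteq> {1..n} \<and> card C = c \<and> T \<subseteq> C}" by auto
      also have "real (card \<dots>) = real (n choose c) * poly ff (real c)"
        unfolding ff using T c(1) by (intro card_subsets_containing) (auto simp: e_def)
      also have "real (n choose c) * poly ff (real c) / real (n choose c) = poly ff (real c)"
        using c(1) by simp
      also have "real c = real_of_int (Y - weight R) / 2 ^ (n - 1)"
        unfolding c(2)[symmetric] by simp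
      finally show ?thesis unfolding H .
    qed
    have "average n z (\<lambda>x. \<Prod>v\<in>S. (1 + x v) / 2) =
       (\<Sum>(R, C)\<in>Sigma (residue_sets n Y) ?Cs. of_bool (S \<subseteq> cells n R C) / real (n choose card C))"
      unfolding average_def b configs_def Y_def ..
    also have "\<dots> = (\<Sum>R\<in>residue_sets n Y. \<Sum>C\<in>?Cs R. of_bool (S \<subseteq> cells n R C) / real (n choose card C))"
      by (rule sum.Sigma[symmetric]) auto
    also have "\<dots> = (\<Sum>R\<in>residue_sets n Y. of_bool good *
        (of_bool (S1 \<subseteq> R) * poly H (real_of_int (Y - weight R))))"
    proof (rule sum.cong[OF refl])
      fix R assume R: "R \<in> residue_sets n Y"
      then have "R \<subseteq> free_cells n" by (simp add: residue_sets_def)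
      show "(\<Sum>C\<in>?Cs R. of_bool (S \<subseteq> cells n R C) / real (n choose card C)) =
         of_bool good * (of_bool (S1 \<subseteq> R) * poly H (real_of_int (Y - weight R)))"
        unfolding sub[OF \<open>R \<subseteq> free_cells n\<close>] inner[OF R, symmetric] sum_distrib_left
        by (intro sum.cong refl) simp
    qed
    also have "\<dots> = of_bool good * poly P (real_of_int Y)"
      unfolding sum_distrib_left[symmetric] P(2) ..
    also have "\<dots> = poly P' (real_of_int z)"
      unfolding P'_def by (simp add: poly_pcompose Y_def target_def)
    finally show ?thesis .
  qed
  ultimately show ?thesis by blast
qed

lemma average_polynomial:
  assumes "n \<ge> 3" "d < n - 2" "multilinear (grid n) d g"
  shows "\<exists>P :: real poly. degree P \<le> d \<and>
    (\<forall>z. \<bar>z\<bar> \<le> 2 ^ (n - 1) \<longrightarrow> average n z g = poly P (real_of_int z))"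
  using assms(3)
proof (induction rule: multilinear.induct)
  case (basis S) then show ?case using average_basis_polynomial assms by blast
next
  case (add f g)
  then obtain P Q where P: "degree P \<le> d" "\<forall>z. \<bar>z\<bar> \<le> 2 ^ (n - 1) \<longrightarrow> average n z f = poly P (real_of_int z)"
    and Q: "degree Q \<le> d" "\<forall>z. \<bar>z\<bar> \<le> 2 ^ (n - 1) \<longrightarrow> average n z g = poly Q (real_of_int z)" by blast
  show ?case
    by (rule exI[of _ "P + Q"]) (use P Q in \<open>auto simp: average_add intro: degree_add_le\<close>)
next
  case (scale f c)
  then obtain P where P: "degree P \<le> d" "\<forall>z. \<bar>z\<bar> \<le> 2 ^ (n - 1) \<longrightarrow> average n z f = poly P (real_of_int z)"
    by blast
  show ?case
    by (rule exI[of _ "smult c P"])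
      (use P in \<open>auto simp: average_scale intro: order_trans[OF degree_smult_le]\<close>)
next
  case (cong f g)
  then show ?case using average_cong[of n f g] by simp
qed

lemma average_mono:
  assumes "\<And>R C. (R, C) \<in> configs n z \<Longrightarrow>
    f (sign_point (grid n) (cells n R C)) \<le> g (sign_point (grid n) (cells n R C))"
  shows "average n z f \<le> average n z g"
  unfolding average_def by (rule sum_mono) (auto intro!: divide_right_mono assms)

lemma average_pos:
  assumes "n \<ge> 3" "\<bar>z\<bar> \<le> 2 ^ (n - 1)" "\<And>x. x \<in> sign_cube (grid n) \<Longrightarrow> g x > 0"
  shows "average n z g > 0"
  unfolding average_def
proof (rule sum_pos)
  fix i assume i: "i \<in> configs n z"
  obtain R C where RC: "i = (R, C)" by (cases i)
  have "C \<subseteq> {1..n}" using i RC by (auto simp: configs_def)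
  then have "card C \<le> n" using card_mono[of "{1..n}" C] by simp
  then show "0 < (case i of (R, C) \<Rightarrow> g (sign_point (grid n) (cells n R C)) / real (n choose card C))"
    unfolding RC using assms(3) by simp
qed (use configs_nonempty[OF assms(1,2)] in auto)

section \<open>The lower bound\<close>

lemma rational_approx_degree_bound:
  assumes p: "p \<in> poly_fun (grid n) d" and q: "q \<in> poly_fun (grid n) d"
    and q0: "\<And>x. x \<in> sign_cube (grid n) \<Longrightarrow> q x \<noteq> 0"
    and approx: "\<And>x. x \<in> sign_cube (grid n) \<Longrightarrow> \<bar>halfspace n x - p x / q x\<bar> \<le> \<epsilon>"
    and "\<epsilon> < 1" "2 * d < n - 2" "n \<ge> 3" "w \<ge> 6" "(4 * d + 1) * w < n"
  shows "(1 - \<epsilon>) * 2 ^ (w - 6) \<le> 7"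
proof -
  have mp: "multilinear (grid n) (2 * d) (\<lambda>x. p x * q x)"
    using poly_fun_mult[OF p q] by (intro poly_fun_multilinear) (simp add: mult_2)
  have mq: "multilinear (grid n) (2 * d) (\<lambda>x. q x * q x)"
    using poly_fun_mult[OF q q] by (intro poly_fun_multilinear) (simp add: mult_2)
  obtain P where P: "degree P \<le> 2 * d"
    "\<And>z. \<bar>z\<bar> \<le> 2 ^ (n - 1) \<Longrightarrow> average n z (\<lambda>x. p x * q x) = poly P (real_of_int z)"
    using average_polynomial[OF \<open>n \<ge> 3\<close> \<open>2 * d < n - 2\<close> mp] by blast
  obtain Q where Q: "degree Q \<le> 2 * d"
    "\<And>z. \<bar>z\<bar> \<le> 2 ^ (n - 1) \<Longrightarrow> average n z (\<lambda>x. q x * q x) = poly Q (real_of_int z)"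
    using average_polynomial[OF \<open>n \<ge> 3\<close> \<open>2 * d < n - 2\<close> mq] by blast
  have pt: "(1 - \<epsilon>) * (q x * q x) \<le> halfspace n x * (p x * q x) \<and>
      halfspace n x * (p x * q x) \<le> 2 * (q x * q x)"
    if x: "x \<in> sign_cube (grid n)" and h: "halfspace n x = 1 \<or> halfspace n x = -1" for x
  proof -
    define r where "r = halfspace n x * (p x / q x)"
    have r: "1 - \<epsilon> \<le> r" "r \<le> 2" using approx[OF x] h \<open>\<epsilon> < 1\<close> by (auto simp: r_def)
    have "halfspace n x * (p x * q x) = r * (q x * q x)" using q0[OF x] by (simp add: r_def)
    then show ?thesis using r by (simp only: mult_right_mono zero_le_square)
  qed
  have k: "\<bar>2 ^ k :: int\<bar> \<le> 2 ^ (n - 1)" "\<bar>- (2 ^ k) :: int\<bar> \<le> 2 ^ (n - 1)" if "k < n" for k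
    using that by (auto intro: power_increasing)
  have Qpos: "poly Q (real_of_int z) > 0" if z: "\<bar>z\<bar> \<le> 2 ^ (n - 1)" for z
    unfolding Q(2)[OF z, symmetric]
    by (rule average_pos[OF \<open>n \<ge> 3\<close> z]) (use q0 not_real_square_gt_zero in blast)
  have bounds: "(1 - \<epsilon>) * poly Q (real_of_int z) \<le> \<sigma> * poly P (real_of_int z) \<and>
      \<sigma> * poly P (real_of_int z) \<le> 2 * poly Q (real_of_int z)"
    if z: "\<bar>z\<bar> \<le> 2 ^ (n - 1)" and \<sigma>: "\<sigma> = (if z \<ge> 0 then 1 else - 1)" for z \<sigma>
    unfolding P(2)[OF z, symmetric] Q(2)[OF z, symmetric] average_scale[symmetric]
    using pt[OF sign_point_in_cube] halfspace_config[of n _ _ z] \<open>n \<ge> 3\<close>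
    unfolding \<sigma> by (intro conjI average_mono) fastforce+
  show ?thesis
  proof (rule univariate_sign_gap[OF P(1) Q(1)])
    show "0 < 1 - \<epsilon>" "6 \<le> w" "(2 * (2 * d) + 1) * w < n" using assms by auto
    fix j assume j: "j < n"
    show "poly Q (2 ^ j) > 0" "poly Q (- (2 ^ j)) > 0"
      using Qpos[OF k(1)[OF j]] Qpos[OF k(2)[OF j]] by auto
    show "(1 - \<epsilon>) * poly Q (2 ^ j) \<le> poly P (2 ^ j)" "poly P (2 ^ j) \<le> 2 * poly Q (2 ^ j)"
      using bounds[OF k(1)[OF j] refl] by auto
    have "(1 - \<epsilon>) * poly Q (- (2 ^ j)) \<le> - poly P (- (2 ^ j))"
      using bounds[OF k(2)[OF j] refl] by auto
    moreover have "(1 - \<epsilon>) * poly Q (- (2 ^ j)) > 0"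
      using Qpos[OF k(2)[OF j]] \<open>\<epsilon> < 1\<close> by simp
    ultimately show "poly P (- (2 ^ j)) < 0" by linarith
  qed
qed

lemma multilinear_0_const:
  assumes "multilinear V 0 f" shows "\<exists>c. \<forall>x\<in>sign_cube V. f x = c"
  using assms
proof (induction rule: multilinear.induct)
  case (basis S) then show ?case by auto
next
  case (cong f g) then show ?case by metis
qed auto

lemma rational_approx_degree_pos:
  assumes p: "p \<in> poly_fun (grid n) d" and q: "q \<in> poly_fun (grid n) d"
    and approx: "\<And>x. x \<in> sign_cube (grid n) \<Longrightarrow> \<bar>halfspace n x - p x / q x\<bar> \<le> \<epsilon>"
    and "\<epsilon> < 1" "n \<ge> 1"
  shows "d \<ge> 1"
proof (rule ccontr)
  assume "\<not> ?thesis"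
  then have "d = 0" by simp
  obtain a where a: "\<forall>x\<in>sign_cube (grid n). p x = a"
    using multilinear_0_const poly_fun_multilinear p unfolding \<open>d = 0\<close> by blast
  obtain b where b: "\<forall>x\<in>sign_cube (grid n). q x = b"
    using multilinear_0_const poly_fun_multilinear q unfolding \<open>d = 0\<close> by blast
  define L where "L = (\<Sum>i=1..n. \<Sum>j=1..n. 2 ^ i :: real)"
  have "(\<Sum>i=1..n. \<Sum>j=1..n. 2 :: real) \<le> L"
    unfolding L_def by (intro sum_mono) (use power_increasing[of 1 _ "2::real"] in auto)
  moreover have "(\<Sum>i=1..n. \<Sum>j=1..n. 2 :: real) = real (n * n) * 2" by simp
  moreover have "real (n * n) \<ge> 1" using \<open>n \<ge> 1\<close> by (metis mult_le_mono nat_mult_1 of_nat_1 of_nat_le_iff)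
  ultimately have L: "L \<ge> 2" by linarith
  have "(\<Sum>i=1..n. \<Sum>j=1..n. 2 ^ i * sign_point (grid n) (grid n) (i, j)) = L"
    unfolding L_def by (intro sum.cong refl) (auto simp: sign_point_def grid_def)
  then have h1: "halfspace n (sign_point (grid n) (grid n)) = 1"
    unfolding halfspace_def using L by simp
  have "(\<Sum>i=1..n. \<Sum>j=1..n. 2 ^ i * sign_point (grid n) {} (i, j)) = (\<Sum>i=1..n. \<Sum>j=1..n. - (2 ^ i))"
    by (intro sum.cong refl) (auto simp: sign_point_def grid_def)
  also have "\<dots> = - L" unfolding L_def by (simp add: sum_negf)
  finally have h2: "halfspace n (sign_point (grid n) {}) = - 1"
    unfolding halfspace_def using L by simp
  have "\<bar>1 - a / b\<bar> \<le> \<epsilon>" "\<bar>- 1 - a / b\<bar> \<le> \<epsilon>"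
    using approx[of "sign_point (grid n) (grid n)"] approx[of "sign_point (grid n) {}"] a b h1 h2 by auto
  then show False using \<open>\<epsilon> < 1\<close> by linarith
qed

lemma rdeg_halfspace_lower:
  assumes n: "n \<ge> 1" and eps: "1/3 < \<epsilon>" "\<epsilon> < 1"
  shows "1/106 * (1 + real n / log 2 (1 / (1 - \<epsilon>)))
    \<le> real (rdeg (grid n) (sign_cube (grid n)) (halfspace n) \<epsilon>)"
proof -
  define d where "d = rdeg (grid n) (sign_cube (grid n)) (halfspace n) \<epsilon>"
  define l where "l = log 2 (1 / (1 - \<epsilon>))"
  have "0 < \<epsilon>" using eps by simp
  obtain p0 q0 where pq0: "p0 \<in> poly_fun (grid n) (8 * n)" "q0 \<in> poly_fun (grid n) (8 * n)"
    "\<And>x. x \<in> sign_cube (grid n) \<Longrightarrow> q0 x \<noteq> 0"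
    "\<And>x. x \<in> sign_cube (grid n) \<Longrightarrow> \<bar>halfspace n x - p0 x / q0 x\<bar> \<le> \<epsilon>"
    by (rule halfspace_rational_approx[OF n \<open>0 < \<epsilon>\<close>]) blast
  have "\<exists>p\<in>poly_fun (grid n) d. \<exists>q\<in>poly_fun (grid n) d. (\<forall>x\<in>sign_cube (grid n). q x \<noteq> 0) \<and>
      (\<forall>x\<in>sign_cube (grid n). \<bar>halfspace n x - p x / q x\<bar> \<le> \<epsilon>)"
    unfolding d_def by (rule rdeg_attained) (fact pq0)+
  then obtain p q where pq: "p \<in> poly_fun (grid n) d" "q \<in> poly_fun (grid n) d"
    "\<And>x. x \<in> sign_cube (grid n) \<Longrightarrow> q x \<noteq> 0"
    "\<And>x. x \<in> sign_cube (grid n) \<Longrightarrow> \<bar>halfspace n x - p x / q x\<bar> \<le> \<epsilon>"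
    by fast
  have d1: "d \<ge> 1" by (rule rational_approx_degree_pos[OF pq(1,2,4) eps(2) n])
  have powl: "2 powr l = 1 / (1 - \<epsilon>)" unfolding l_def using eps by simp
  have "2 powr (1/2) = sqrt 2" by (simp add: powr_half_sqrt)
  also have "\<dots> \<le> 3/2" by (rule real_le_lsqrt) (auto simp: power2_eq_square)
  also have "\<dots> \<le> 1 / (1 - \<epsilon>)" using eps by (simp add: field_simps)
  also have "\<dots> = 2 powr l" by (simp add: powl)
  finally have l: "l \<ge> 1/2" by simp
  have "real n \<le> 105 * (real d * l)"
  proof (cases "2 * d < n - 2")
    case False
    then have "n \<le> 4 * d" using d1 by linarith
    then have "real n \<le> 4 * real d" by linarith
    also have "real d * (1/2) \<le> real d * l" using l by (intro mult_left_mono) auto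
    then have "4 * real d \<le> 105 * (real d * l)" using d1 by linarith
    finally show ?thesis .
  next
    case True
    define w where "w = nat \<lfloor>l\<rfloor> + 10"
    have "n \<ge> 3" using True by simp
    have "n \<le> (4 * d + 1) * w"
    proof (rule ccontr)
      assume "\<not> ?thesis"
      then have "(1 - \<epsilon>) * 2 ^ (w - 6) \<le> 7"
        using rational_approx_degree_bound[OF pq eps(2) True \<open>n \<ge> 3\<close>, of w] by (simp add: w_def)
      moreover have "2 powr (l + 3) \<le> 2 powr real (w - 6)" using l unfolding w_def by simp linarith
      then have "2 powr l * 8 \<le> 2 ^ (w - 6)" by (simp add: powr_add powr_realpow)
      then have "(1 - \<epsilon>) * (2 powr l * 8) \<le> (1 - \<epsilon>) * 2 ^ (w - 6)" using eps by (intro mult_left_mono) auto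
      moreover have "(1 - \<epsilon>) * (2 powr l * 8) = 8" using eps by (simp add: powl field_simps)
      ultimately show False by linarith
    qed
    then have "real n \<le> real ((4 * d + 1) * w)" by (simp only: of_nat_le_iff)
    also have "\<dots> = (4 * real d + 1) * real w" by (simp add: algebra_simps)
    also have "\<dots> \<le> (5 * real d) * (21 * l)"
      using d1 l unfolding w_def by (intro mult_mono) (auto, linarith)
    finally show ?thesis by simp
  qed
  then have "real n / l \<le> 105 * real d" using l by (simp add: pos_divide_le_eq mult_ac)
  then have "1 + real n / l \<le> 106 * real d" using d1 by linarith
  then show ?thesis unfolding d_def l_def by simp
qed

theorem theorem1p6:
  "(\<exists>c C :: real. c > 0 \<and> C > 0 \<and>
      (\<forall>n :: nat. \<forall>\<epsilon> :: real. n \<ge> 1 \<and> 1/3 < \<epsilon> \<and> \<epsilon> < 1 \<longrightarrow>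
         c * (1 + real n / log 2 (1 / (1 - \<epsilon>)))
           \<le> real (rdeg (grid n) (sign_cube (grid n)) (halfspace n) \<epsilon>) \<and>
         real (rdeg (grid n) (sign_cube (grid n)) (halfspace n) \<epsilon>)
           \<le> C * (1 + real n / log 2 (1 / (1 - \<epsilon>))))) \<and>
   (\<forall>n :: nat. \<forall>\<epsilon> :: real. n \<ge> 1 \<and> \<epsilon> > 0 \<longrightarrow>
      int (rdeg (grid n) (sign_cube (grid n)) (halfspace n) \<epsilon>)
        \<le> 64 * int n * \<lceil>log 2 (real n)\<rceil> + 1)"
proof (rule conjI)
  have "\<forall>n \<epsilon>. n \<ge> 1 \<and> 1/3 < \<epsilon> \<and> \<epsilon> < 1 \<longrightarrow>
      1/106 * (1 + real n / log 2 (1 / (1 - \<epsilon>)))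
        \<le> real (rdeg (grid n) (sign_cube (grid n)) (halfspace n) \<epsilon>) \<and>
      real (rdeg (grid n) (sign_cube (grid n)) (halfspace n) \<epsilon>)
        \<le> 6 * (1 + real n / log 2 (1 / (1 - \<epsilon>)))"
    using rdeg_halfspace_lower rdeg_halfspace_upper by auto
  moreover have "(1/106 :: real) > 0" "(6 :: real) > 0" by simp_all
  ultimately show "\<exists>c C :: real. c > 0 \<and> C > 0 \<and>
      (\<forall>n :: nat. \<forall>\<epsilon> :: real. n \<ge> 1 \<and> 1/3 < \<epsilon> \<and> \<epsilon> < 1 \<longrightarrow>
         c * (1 + real n / log 2 (1 / (1 - \<epsilon>)))
           \<le> real (rdeg (grid n) (sign_cube (grid n)) (halfspace n) \<epsilon>) \<and>
         real (rdeg (grid n) (sign_cube (grid n)) (halfspace n) \<epsilon>)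
           \<le> C * (1 + real n / log 2 (1 / (1 - \<epsilon>))))"
    by (intro exI conjI)
qed (use rdeg_halfspace_le in auto)

end
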